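(* Let $T$ be a compact torus acting smoothly on a manifold $X$. (a) If $A$ is a pointwise assignment on $X$, then $A$ is constant on each infinitesimal stratum $Y$ of $X$. If $A'(Y)$ denotes the common value of all $A(p)$, $p\in Y$, then the map $Y\mapsto A'(Y)$ is a stratum assignment. (b) If $A'$ is a stratum assignment on $X$, then the map $A$ given by $A(p):=A'(Y)$, where $Y$ is the infinitesimal stratum containing $p$, is a pointwise assignment on $X$.
   Context: $\mathfrak{t}$ is the Lie algebra of $T$; for $p\in X$, $\mathfrak{t}_p\subset\mathfrak{t}$ is the Lie algebra of the isotropy group $T_p$. For a subspace $\mathfrak{h}\subset\mathfrak{t}$, $S(\mathfrak{h}^* )$ is the algebra of real polynomial functions on $\mathfrak{h}$. A pointwise assignment is a map $A$ assigning to each $p\in X$ a polynomial $A(p)\in S(\mathfrak{t}_p^* )$ such that for every (connected) subtorus $H\subset T$ with Lie algebra $\mathfrak{h}$, the map $p\mapsto A(p)|_{\mathfrak{h}}$ is locally constant on the fixed point set $X^H$. The infinitesimal strata of $X$ are the connected components of the spaces of the form $\{p\in X\mid\mathfrak{t}_p=\mathfrak{h}\}$, where $\mathfrak{h}$ is an infinitesimal isotropy (i.e. $\mathfrak h=\mathfrak t_q$ for some $q\in X$). For a stratum $Y$ put $\mathfrak{t}_Y:=\mathfrak{t}_p$ for any $p\in Y$. Strata are partially ordered by: $Y\preceq Z$ if and only if $Y\subset\overline{Z}$; in that case $\mathfrak{t}_Z\subset\mathfrak{t}_Y$. A stratum assignment is a function $A'$ that associates to each infinitesimal stratum $Y$ a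 polynomial $A'(Y)\in S(\mathfrak{t}_Y^* )$ such that $Y\preceq Z$ implies $A'(Z)=A'(Y)|_{\mathfrak{t}_Z}$. *)

theory Defs
  imports "HOL-Analysis.Analysis" "HOL-Algebra.Group_Action"
begin

section \<open>Smooth maps\<close>

text \<open>Continuous differentiability of order \<open>k\<close>; meant for open sets \<open>U\<close>.\<close>

fun Ck_on :: "nat \<Rightarrow> 'a::euclidean_space set \<Rightarrow> ('a \<Rightarrow> 'b::euclidean_space) \<Rightarrow> bool" where
  "Ck_on 0 U f \<longleftrightarrow> continuous_on U f"
| "Ck_on (Suc k) U f \<longleftrightarrow>
     (\<exists>f'. (\<forall>x\<in>U. (f has_derivative f' x) (at x)) \<and> (\<forall>v. Ck_on k U (\<lambda>x. f' x v)))"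

text \<open>Smoothness on an arbitrary subset of a Euclidean space: local existence of smooth extensions.
  On (relatively) open subsets of a linear subspace, or of an embedded submanifold such as a torus
  in \<open>complex ^ 'n\<close>, this is the usual intrinsic notion.\<close>

definition smooth_on :: "'a::euclidean_space set \<Rightarrow> ('a \<Rightarrow> 'b::euclidean_space) \<Rightarrow> bool" where
  "smooth_on S f \<longleftrightarrow>
     (\<forall>x\<in>S. \<exists>U g. open U \<and> x \<in> U \<and> (\<forall>k. Ck_on k U g) \<and> (\<forall>y\<in>S \<inter> U. g y = f y))"


section \<open>Smooth manifolds\<close>

text \<open>The manifold is the whole type \<open>'x\<close>, which will be Hausdorff and second countable. It is
  modelled on a linear subspace \<open>E\<close> of a Euclidean space, so that its dimension is \<open>dim E\<close>, which
  may be \<open>0\<close> although \<open>DIM('e) > 0\<close>.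
  A chart is a pair of its domain and its coordinate map.\<close>

definition smooth_atlas ::
    "'e::euclidean_space set \<Rightarrow> ('x::topological_space set \<times> ('x \<Rightarrow> 'e)) set \<Rightarrow> bool" where
  "smooth_atlas E \<A> \<longleftrightarrow>
     subspace E \<and>
     (\<Union>(U, \<phi>)\<in>\<A>. U) = UNIV \<and>
     (\<forall>(U, \<phi>)\<in>\<A>. open U \<and> openin (top_of_set E) (\<phi> ` U) \<and>
        homeomorphism U (\<phi> ` U) \<phi> (inv_into U \<phi>)) \<and>
     (\<forall>(U, \<phi>)\<in>\<A>. \<forall>(V, \<psi>)\<in>\<A>. smooth_on (\<phi> ` (U \<inter> V)) (\<psi> \<circ> inv_into U \<phi>))"


section \<open>Tori and smooth torus actions\<close>

text \<open>The compact torus of rank \<open>card I\<close>: the product of the circles with indices in \<open>I\<close>. The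
  remaining coordinates are \<open>1\<close>; allowing \<open>I \<noteq> UNIV\<close> includes the torus of rank \<open>0\<close>.\<close>

definition torus :: "'n::finite set \<Rightarrow> (complex ^ 'n) monoid" where
  "torus I = \<lparr>carrier = {z. (\<forall>i\<in>I. norm (z $ i) = 1) \<and> (\<forall>i. i \<notin> I \<longrightarrow> z $ i = 1)},
              mult = (\<lambda>z w. z * w), one = 1\<rparr>"

definition subtorus :: "(complex ^ 'n::finite) set \<Rightarrow> (complex ^ 'n) monoid \<Rightarrow> bool" where
  "subtorus H T \<longleftrightarrow> subgroup H T \<and> closed H \<and> connected H"

definition torus_exp :: "real ^ 'n::finite \<Rightarrow> complex ^ 'n" where
  "torus_exp v = (\<chi> i. cis (v $ i))"

text \<open>The Lie algebra of a closed subgroup, as the space of its one-parameter subgroups.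
  For \<open>torus I\<close> itself this is the coordinate subspace of \<open>real ^ 'n\<close> belonging to \<open>I\<close>.\<close>

definition lie_algebra :: "(complex ^ 'n::finite) set \<Rightarrow> (real ^ 'n) set" where
  "lie_algebra H = {v. \<forall>s. torus_exp (s *\<^sub>R v) \<in> H}"

text \<open>Joint smoothness of \<open>T \<times> X \<rightarrow> X\<close> is expressed in charts of \<open>X\<close>, with \<open>T\<close> regarded as a
  submanifold of \<open>complex ^ 'n\<close>.\<close>

definition smooth_action ::
    "('x::topological_space set \<times> ('x \<Rightarrow> 'e::euclidean_space)) set \<Rightarrow> (complex ^ 'n::finite) monoid
      \<Rightarrow> (complex ^ 'n \<Rightarrow> 'x \<Rightarrow> 'x) \<Rightarrow> bool" where
  "smooth_action \<A> T act \<longleftrightarrow>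
     group_action T UNIV act \<and>
     continuous_on (carrier T \<times> UNIV) (\<lambda>(z, p). act z p) \<and>
     (\<forall>(U, \<phi>)\<in>\<A>. \<forall>(V, \<psi>)\<in>\<A>.
        smooth_on {(z, y). z \<in> carrier T \<and> y \<in> \<phi> ` U \<and> act z (inv_into U \<phi> y) \<in> V}
          (\<lambda>(z, y). \<psi> (act z (inv_into U \<phi> y))))"

definition isotropy_algebra ::
    "(complex ^ 'n::finite) monoid \<Rightarrow> (complex ^ 'n \<Rightarrow> 'x \<Rightarrow> 'x) \<Rightarrow> 'x \<Rightarrow> (real ^ 'n) set" where
  "isotropy_algebra T act p = lie_algebra (stabilizer T act p)"

definition fixed_set :: "('g \<Rightarrow> 'x \<Rightarrow> 'x) \<Rightarrow> 'g set \<Rightarrow> 'x set" where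
  "fixed_set act H = {p. \<forall>z\<in>H. act z p = p}"


section \<open>Assignments\<close>

text \<open>The algebra \<open>S(h\<^sup>*)\<close> of polynomial functions on a subspace \<open>h\<close>. Its elements are
  extensional functions, so that equality of functions is equality on \<open>h\<close>. Since linear
  functionals on \<open>h\<close> extend to the ambient space, these are the restrictions of ambient
  polynomial functions. The restriction of \<open>f\<close> to a smaller subspace \<open>k\<close> is \<open>restrict f k\<close>.\<close>

definition polynomials_on :: "(real ^ 'n::finite) set \<Rightarrow> (real ^ 'n \<Rightarrow> real) set" where
  "polynomials_on h = {restrict g h | g. real_polynomial_function g}"

definition pointwise_assignment ::
    "(complex ^ 'n::finite) monoid \<Rightarrow> (complex ^ 'n \<Rightarrow> 'x::topological_space \<Rightarrow> 'x)
      \<Rightarrow> ('x \<Rightarrow> real ^ 'n \<Rightarrow> real) \<Rightarrow> bool" where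
  "pointwise_assignment T act A \<longleftrightarrow>
     (\<forall>p. A p \<in> polynomials_on (isotropy_algebra T act p)) \<and>
     (\<forall>H. subtorus H T \<longrightarrow>
        locally (\<lambda>U. (\<lambda>p. restrict (A p) (lie_algebra H)) constant_on U) (fixed_set act H))"

definition infinitesimal_strata ::
    "(complex ^ 'n::finite) monoid \<Rightarrow> (complex ^ 'n \<Rightarrow> 'x::topological_space \<Rightarrow> 'x)
      \<Rightarrow> 'x set set" where
  "infinitesimal_strata T act =
     (\<Union>q. components {p. isotropy_algebra T act p = isotropy_algebra T act q})"

text \<open>The common value of \<open>isotropy_algebra T act p\<close> for \<open>p \<in> Y\<close>.\<close>

definition stratum_algebra ::
    "(complex ^ 'n::finite) monoid \<Rightarrow> (complex ^ 'n \<Rightarrow> 'x \<Rightarrow> 'x) \<Rightarrow> 'x set \<Rightarrow> (real ^ 'n) set" where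
  "stratum_algebra T act Y = (THE h. \<forall>p\<in>Y. isotropy_algebra T act p = h)"

text \<open>Values of \<open>A'\<close> at sets that are not strata are irrelevant.\<close>

definition stratum_assignment ::
    "(complex ^ 'n::finite) monoid \<Rightarrow> (complex ^ 'n \<Rightarrow> 'x::topological_space \<Rightarrow> 'x)
      \<Rightarrow> ('x set \<Rightarrow> real ^ 'n \<Rightarrow> real) \<Rightarrow> bool" where
  "stratum_assignment T act A' \<longleftrightarrow>
     (\<forall>Y\<in>infinitesimal_strata T act. A' Y \<in> polynomials_on (stratum_algebra T act Y)) \<and>
     (\<forall>Y\<in>infinitesimal_strata T act. \<forall>Z\<in>infinitesimal_strata T act.
        Y \<subseteq> closure Z \<longrightarrow> A' Z = restrict (A' Y) (stratum_algebra T act Z))"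

definition common_value :: "('x \<Rightarrow> 'b) \<Rightarrow> 'x set \<Rightarrow> 'b" where
  "common_value A Y = (THE c. \<forall>p\<in>Y. A p = c)"

definition stratum_of ::
    "(complex ^ 'n::finite) monoid \<Rightarrow> (complex ^ 'n \<Rightarrow> 'x::topological_space \<Rightarrow> 'x)
      \<Rightarrow> 'x \<Rightarrow> 'x set" where
  "stratum_of T act p = (THE Y. Y \<in> infinitesimal_strata T act \<and> p \<in> Y)"

end

theory Submission
  imports Defs
begin

text \<open>Each isotropy algebra \<open>isot q\<close> is the Lie algebra of a subtorus that fixes \<open>q\<close>, namely the closure
  of the image of \<open>isot q\<close> under the exponential map. The fixed points of this subtorus are the points
  whose isotropy algebra contains \<open>isot q\<close>, and they form a closed set. Hence for a stratum \<open>Z\<close> the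
  connected set \<open>closure Z\<close> lies in one such fixed point set, and a pointwise assignment, restricted
  to the Lie algebra of \<open>Z\<close>, is constant on \<open>closure Z\<close>. This is the first half
  (\<open>assignment_restrict_closure\<close>).

  The second half rests on the frontier condition: every \<open>p\<close> has a neighbourhood \<open>V\<close> such that the
  strata that meet \<open>V\<close> contain the stratum of \<open>p\<close> in their closure (\<open>frontier_condition\<close>). Near \<open>p\<close>
  the values of a stratum assignment are then restrictions of its value at the stratum of \<open>p\<close>, which
  is local constancy.

  The frontier condition is local, because strata are connected. Near \<open>p\<close> isotropy algebras are
  contained in \<open>h = isot p\<close>: transversally to \<open>h\<close> the stabilizer of \<open>p\<close> is discrete, so the torus
  has no small one-parameter subgroups relative to it (\<open>iso_upper_semicontinuous\<close>). It remains to
  understand the action of \<open>h\<close> near its fixed point \<open>p\<close>. By Bochner's averaging argument it is linear in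
  a suitable chart (\<open>linearization\<close>). The average is taken over one circle after another,
  which requires that \<open>h\<close> is spanned by periods of the exponential map; this follows from Dirichlet's
  approximation theorem (\<open>lie_algebra_rational\<close>). In a linear chart the isotropy algebra is constant
  along the segment from a fixed point of \<open>h\<close>, excluded, to any other point, so every stratum near
  \<open>p\<close> has all nearby points of the stratum of \<open>p\<close> in its closure (\<open>conical_strata\<close>).\<close>


section \<open>The torus and the Lie algebras of its subgroups\<close>
lemma torus_exp_add: "torus_exp (v + w) = torus_exp v * torus_exp w"
  by (simp add: torus_exp_def vec_eq_iff cis_mult)

lemma torus_exp_0: "torus_exp 0 = 1"
  by (simp add: torus_exp_def vec_eq_iff)

lemma continuous_on_torus_exp [continuous_intros]:
  assumes "continuous_on S f" shows "continuous_on S (\<lambda>x. torus_exp (f x))"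
  unfolding torus_exp_def cis_conv_exp by (intro continuous_intros assms)

lemma continuous_on_mult_vec [continuous_intros]:
  fixes f g :: "'a::topological_space \<Rightarrow> complex ^ 'n::finite"
  assumes "continuous_on S f" "continuous_on S g"
  shows "continuous_on S (\<lambda>x. f x * g x)"
  unfolding times_vec_def by (intro continuous_intros assms)

lemma compact_torus: "compact (carrier (torus I))"
proof -
  have "carrier (torus I) = {z. \<forall>i. if i \<in> I then norm (z $ i) = 1 else z $ i = 1}"
    by (auto simp: torus_def)
  also have "closed \<dots>"
  proof (intro closed_Collect_all)
    fix i
    show "closed {z :: complex ^ 'a. if i \<in> I then norm (z $ i) = 1 else z $ i = 1}"
      by (cases "i \<in> I") (auto intro!: closed_Collect_eq continuous_intros)
  qed
  finally have "closed (carrier (torus I))" .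
  moreover have "norm z \<le> (\<Sum>i\<in>(UNIV :: 'a set). 1)" if "z \<in> carrier (torus I)" for z
  proof -
    have "norm z \<le> (\<Sum>i\<in>UNIV. norm (z $ i))"
      unfolding norm_vec_def by (intro L2_set_le_sum) simp
    also have "\<dots> \<le> (\<Sum>i\<in>(UNIV :: 'a set). 1)"
    proof (rule sum_mono)
      fix i
      have "norm (z $ i) = 1" using that by (cases "i \<in> I") (auto simp: torus_def)
      then show "norm (z $ i) \<le> 1" by simp
    qed
    finally show ?thesis .
  qed
  ultimately show ?thesis
    unfolding compact_eq_bounded_closed bounded_iff by blast
qed

lemma one_torus: "\<one>\<^bsub>torus I\<^esub> = 1" and mult_torus: "z \<otimes>\<^bsub>torus I\<^esub> w = z * w"
  by (simp_all add: torus_def)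

lemma cnj_torus:
  assumes "z \<in> carrier (torus I)"
  shows "(\<chi> i. cnj (z $ i)) \<in> carrier (torus I)" "(\<chi> i. cnj (z $ i)) * z = 1"
proof -
  show "(\<chi> i. cnj (z $ i)) \<in> carrier (torus I)" using assms by (simp add: torus_def)
  have "cnj (z $ i) * z $ i = 1" for i
    using assms complex_norm_square[of "z $ i"]
    by (cases "i \<in> I") (auto simp: torus_def mult.commute)
  then show "(\<chi> i. cnj (z $ i)) * z = 1" by (simp add: vec_eq_iff)
qed

lemma group_torus: "group (torus I)"
proof (rule groupI)
  fix z assume "z \<in> carrier (torus I)"
  from cnj_torus[OF this] show "\<exists>w\<in>carrier (torus I). w \<otimes>\<^bsub>torus I\<^esub> z = \<one>\<^bsub>torus I\<^esub>"
    by (intro bexI) (simp_all add: mult_torus one_torus)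
qed (auto simp: torus_def norm_mult mult.assoc)

lemma inv_torus:
  "z \<in> carrier (torus I) \<Longrightarrow> inv\<^bsub>torus I\<^esub> z = (\<chi> i. cnj (z $ i))"
  by (rule group.inv_equality[OF group_torus])
    (simp_all add: cnj_torus mult_torus one_torus)

lemma inv_torus_exp:
  assumes "torus_exp v \<in> carrier (torus I)"
  shows "inv\<^bsub>torus I\<^esub> (torus_exp v) = torus_exp (- v)"
proof (rule group.inv_equality[OF group_torus _ assms])
  show "torus_exp (- v) \<otimes>\<^bsub>torus I\<^esub> torus_exp v = \<one>\<^bsub>torus I\<^esub>"
    by (simp add: mult_torus one_torus torus_exp_0 flip: torus_exp_add)
  show "torus_exp (- v) \<in> carrier (torus I)"
    using assms by (auto simp: torus_def torus_exp_def simp flip: cis_cnj)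
qed

lemma lie_algebraD: "v \<in> lie_algebra S \<Longrightarrow> torus_exp (s *\<^sub>R v) \<in> S"
  by (simp add: lie_algebra_def)

lemma lie_algebra_exp: "v \<in> lie_algebra S \<Longrightarrow> torus_exp v \<in> S"
  using lie_algebraD[of v S 1] by simp

lemma subspace_lie_algebra:
  assumes "subgroup S (torus I)" shows "subspace (lie_algebra S)"
proof (rule subspaceI)
  show "0 \<in> lie_algebra S"
    using subgroup.one_closed[OF assms] by (simp add: lie_algebra_def torus_exp_0 one_torus)
  show "v + w \<in> lie_algebra S" if "v \<in> lie_algebra S" "w \<in> lie_algebra S" for v w
    using subgroup.m_closed[OF assms] that
    by (auto simp: lie_algebra_def scaleR_add_right torus_exp_add mult_torus)
  show "c *\<^sub>R v \<in> lie_algebra S" if "v \<in> lie_algebra S" for c v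
    using that by (auto simp: lie_algebra_def)
qed

lemma subgroup_exp_image:
  assumes S: "subgroup S (torus I)"
  shows "subgroup (torus_exp ` lie_algebra S) (torus I)"
proof (rule group.subgroupI[OF group_torus])
  have sub: "subspace (lie_algebra S)" by (rule subspace_lie_algebra[OF S])
  have sc: "torus_exp ` lie_algebra S \<subseteq> carrier (torus I)"
    using subgroup.subset[OF S] lie_algebra_exp by blast
  then show "torus_exp ` lie_algebra S \<subseteq> carrier (torus I)" .
  show "torus_exp ` lie_algebra S \<noteq> {}" using subspace_0[OF sub] by blast
  fix z assume "z \<in> torus_exp ` lie_algebra S"
  then obtain v where v: "v \<in> lie_algebra S" "z = torus_exp v" by blast
  have "inv\<^bsub>torus I\<^esub> z = torus_exp (- v)"
    using inv_torus_exp[of v I] sc v by blast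
  then show "inv\<^bsub>torus I\<^esub> z \<in> torus_exp ` lie_algebra S"
    using subspace_neg[OF sub v(1)] by simp
  fix w assume "w \<in> torus_exp ` lie_algebra S"
  then obtain u where "u \<in> lie_algebra S" "w = torus_exp u" by blast
  then show "z \<otimes>\<^bsub>torus I\<^esub> w \<in> torus_exp ` lie_algebra S"
    using v subspace_add[OF sub] by (force simp: mult_torus simp flip: torus_exp_add)
qed

lemma subgroup_closure:
  assumes S: "subgroup S (torus I)" shows "subgroup (closure S) (torus I)"
proof (rule group.subgroupI[OF group_torus])
  have sc: "closure S \<subseteq> carrier (torus I)"
    by (intro closure_minimal subgroup.subset[OF S] compact_imp_closed compact_torus)
  then show "closure S \<subseteq> carrier (torus I)" .
  show "closure S \<noteq> {}" using subgroup.one_closed[OF S] by auto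
  note inv = inv_torus[of _ I]
  have "(\<lambda>z. \<chi> i. cnj (z $ i)) ` closure S \<subseteq> closure S"
  proof (rule image_closure_subset)
    show "(\<lambda>z. \<chi> i. cnj (z $ i)) ` S \<subseteq> closure S"
    proof (rule image_subsetI)
      fix z assume z: "z \<in> S"
      show "(\<chi> i. cnj (z $ i)) \<in> closure S"
        using subgroup.m_inv_closed[OF S z] subgroup.subset[OF S] z closure_subset[of S]
        unfolding inv[OF subsetD[OF subgroup.subset[OF S] z], symmetric] by blast
    qed
  qed (auto intro!: continuous_intros)
  then show "inv\<^bsub>torus I\<^esub> z \<in> closure S" if "z \<in> closure S" for z
    using that inv sc by (metis (no_types, lifting) image_subset_iff subsetD)
  have "(\<lambda>(z, w). z * w) ` closure (S \<times> S) \<subseteq> closure S"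
  proof (rule image_closure_subset)
    show "(\<lambda>(z, w). z * w) ` (S \<times> S) \<subseteq> closure S"
      using subgroup.m_closed[OF S] closure_subset[of S] by (force simp: mult_torus)
  qed (auto simp: case_prod_unfold intro!: continuous_intros)
  then show "z \<otimes>\<^bsub>torus I\<^esub> w \<in> closure S" if "z \<in> closure S" "w \<in> closure S" for z w
    using that by (auto simp: closure_Times mult_torus)
qed

text \<open>The smallest closed subgroup with the same Lie algebra as the closed subgroup \<open>S\<close>. As
  the closure of a connected subgroup it is a subtorus.\<close>
definition exp_closure :: "(complex ^ 'n::finite) set \<Rightarrow> (complex ^ 'n) set" where
  "exp_closure S = closure (torus_exp ` lie_algebra S)"

lemma exp_closure_subset:
  assumes "closed S" shows "exp_closure S \<subseteq> S"
  unfolding exp_closure_def using lie_algebra_exp by (intro closure_minimal assms) blast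

lemma subtorus_exp_closure:
  assumes "subgroup S (torus I)" shows "subtorus (exp_closure S) (torus I)"
  unfolding subtorus_def exp_closure_def
  by (intro conjI subgroup_closure subgroup_exp_image[OF assms] closed_closure connected_imp_connected_closure
      connected_continuous_image continuous_intros
      convex_connected[OF subspace_imp_convex[OF subspace_lie_algebra[OF assms]]])

text \<open>Taking the closure creates no new one-parameter subgroups because it stays inside \<open>S\<close>.\<close>
lemma lie_algebra_exp_closure:
  assumes S: "subgroup S (torus I)" "closed S"
  shows "lie_algebra (exp_closure S) = lie_algebra S"
proof
  show "lie_algebra (exp_closure S) \<subseteq> lie_algebra S"
    using exp_closure_subset[OF S(2)] by (auto simp: lie_algebra_def)
  show "lie_algebra S \<subseteq> lie_algebra (exp_closure S)"
  proof
    fix v assume "v \<in> lie_algebra S"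
    then have "torus_exp (s *\<^sub>R v) \<in> torus_exp ` lie_algebra S" for s
      using subspace_scale[OF subspace_lie_algebra[OF S(1)]] by blast
    then show "v \<in> lie_algebra (exp_closure S)"
      using closure_subset unfolding lie_algebra_def exp_closure_def by blast
  qed
qed

section \<open>Isotropy algebras and infinitesimal strata\<close>

locale torus_action =
  fixes I :: "'n::finite set" and act :: "complex ^ 'n \<Rightarrow> 'x::t2_space \<Rightarrow> 'x"
  assumes action: "group_action (torus I) UNIV act"
    and continuous_action: "continuous_on (carrier (torus I) \<times> UNIV) (\<lambda>(z, p). act z p)"
begin

abbreviation stab :: "'x \<Rightarrow> (complex ^ 'n) set" where "stab \<equiv> stabilizer (torus I) act"
abbreviation isot :: "'x \<Rightarrow> (real ^ 'n) set" where "isot \<equiv> isotropy_algebra (torus I) act"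
abbreviation strata :: "'x set set" where "strata \<equiv> infinitesimal_strata (torus I) act"

lemma stab_iff: "z \<in> stab p \<longleftrightarrow> z \<in> carrier (torus I) \<and> act z p = p"
  by (simp add: stabilizer_def)

lemma subgroup_stab: "subgroup (stab p) (torus I)"
  using group_action.stabilizer_subgroup[OF action] by blast

lemma act_mult:
  "z \<in> carrier (torus I) \<Longrightarrow> w \<in> carrier (torus I) \<Longrightarrow> act (z * w) p = act z (act w p)"
  using group_action.composition_rule[OF action, of p z w] by (simp add: mult_torus)

lemma act_one: "act 1 p = p"
  using group_action.id_eq_one[OF action] by (metis UNIV_I one_torus restrict_apply)

lemma continuous_on_act:
  assumes "continuous_on S f" "continuous_on S g" "f ` S \<subseteq> carrier (torus I)"
  shows "continuous_on S (\<lambda>x. act (f x) (g x))"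
proof -
  have "continuous_on S (\<lambda>x. (\<lambda>(z, p). act z p) (f x, g x))"
    using assms(3) by (intro continuous_on_compose2[OF continuous_action] continuous_on_Pair assms(1,2)) auto
  then show ?thesis by simp
qed

lemma closed_fixed_set:
  assumes "H \<subseteq> carrier (torus I)" shows "closed (fixed_set act H)"
proof -
  have "fixed_set act H = (\<Inter>z\<in>H. {p. act z p = p})" by (auto simp: fixed_set_def)
  also have "closed \<dots>"
  proof (intro closed_INT ballI closed_Collect_eq continuous_intros)
    fix z assume "z \<in> H"
    then show "continuous_on UNIV (act z)"
      using assms by (intro continuous_on_act) (auto intro: continuous_intros)
  qed
  finally show ?thesis .
qed

lemma closed_stab: "closed (stab p)"
proof -
  have "continuous_on (carrier (torus I)) (\<lambda>z. act z p)"
    by (rule continuous_on_act) (auto intro: continuous_intros)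
  then have "closedin (top_of_set (carrier (torus I))) (carrier (torus I) \<inter> (\<lambda>z. act z p) -` {p})"
    by (rule continuous_closedin_preimage) simp
  moreover have "stab p = carrier (torus I) \<inter> (\<lambda>z. act z p) -` {p}"
    by (auto simp: stab_iff)
  ultimately show ?thesis
    using closedin_closed_trans compact_imp_closed compact_torus by metis
qed

lemma subspace_iso: "subspace (isot p)"
  unfolding isotropy_algebra_def by (rule subspace_lie_algebra[OF subgroup_stab])

lemma iso_iff: "v \<in> isot p \<longleftrightarrow> (\<forall>s. torus_exp (s *\<^sub>R v) \<in> stab p)"
  by (simp add: isotropy_algebra_def lie_algebra_def)

lemma lie_algebra_subset_iso:
  assumes "H \<subseteq> carrier (torus I)" "p \<in> fixed_set act H" shows "lie_algebra H \<subseteq> isot p"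
  using assms(1) assms(2)[unfolded fixed_set_def]
  by (auto simp: iso_iff stab_iff subset_iff dest: lie_algebraD)

text \<open>The subtorus \<open>exp_closure (stab q)\<close> has Lie algebra \<open>isot q\<close>. The set of its fixed points is
  closed and contains every point whose isotropy algebra is at least as large as that of \<open>q\<close>, in
  particular the whole stratum of \<open>q\<close>. This is how strata are related to the fixed point sets in
  the definition of a pointwise assignment.\<close>
lemma fixed_by_isotropy_torus:
  assumes "isot q \<subseteq> isot p" shows "p \<in> fixed_set act (exp_closure (stab q))"
proof -
  have "exp_closure (stab q) \<subseteq> stab p"
    unfolding exp_closure_def using assms lie_algebra_exp[of _ "stab p"]
    by (intro closure_minimal closed_stab) (auto simp: isotropy_algebra_def)
  then show ?thesis by (auto simp: fixed_set_def stab_iff)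
qed

text \<open>Strata are equivalence classes: they are recovered from any of their points.\<close>
lemma mem_stratum_iso:
  assumes "Y \<in> strata" "p \<in> Y"
  shows "Y = connected_component_set {q. isot q = isot p} p"
proof -
  obtain r where r: "Y \<in> components {q. isot q = isot r}"
    using assms(1) by (auto simp: infinitesimal_strata_def)
  then have "isot p = isot r" using in_components_subset assms(2) by blast
  with r obtain x where "Y = connected_component_set {q. isot q = isot p} x"
    by (auto simp: components_def)
  then show ?thesis using assms(2) connected_component_eq by fastforce
qed

lemma stratum_exists: "\<exists>Y\<in>strata. p \<in> Y"
proof
  show "connected_component_set {q. isot q = isot p} p \<in> strata"
    by (auto simp: infinitesimal_strata_def components_def)
  show "p \<in> connected_component_set {q. isot q = isot p} p"
    by simp
qed

lemma stratum_unique: "Y \<in> strata \<Longrightarrow> Z \<in> strata \<Longrightarrow> p \<in> Y \<Longrightarrow> p \<in> Z \<Longrightarrow> Y = Z"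
  by (metis mem_stratum_iso)

lemma stratum_of: "stratum_of (torus I) act p \<in> strata" "p \<in> stratum_of (torus I) act p"
proof -
  have "\<exists>!Y. Y \<in> strata \<and> p \<in> Y" using stratum_exists stratum_unique by blast
  from theI'[OF this]
  show "stratum_of (torus I) act p \<in> strata" "p \<in> stratum_of (torus I) act p"
    by (simp_all add: stratum_of_def)
qed

lemma stratum_nonempty: "Y \<in> strata \<Longrightarrow> Y \<noteq> {}"
  using in_components_nonempty by (auto simp: infinitesimal_strata_def)

lemma connected_stratum: "Y \<in> strata \<Longrightarrow> connected Y"
  using in_components_connected by (auto simp: infinitesimal_strata_def)

lemma iso_on_stratum: "Y \<in> strata \<Longrightarrow> p \<in> Y \<Longrightarrow> q \<in> Y \<Longrightarrow> isot p = isot q"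
  using in_components_subset unfolding infinitesimal_strata_def by blast

lemma stratum_algebra_eq:
  assumes "Y \<in> strata" "p \<in> Y" shows "stratum_algebra (torus I) act Y = isot p"
  unfolding stratum_algebra_def
  by (rule the_equality) (use assms iso_on_stratum in blast)+

end


section \<open>From pointwise assignments to stratum assignments\<close>

context torus_action
begin

lemma restrict_constant_on_connected:
  assumes A: "pointwise_assignment (torus I) act A" and H: "subtorus H (torus I)"
    and C: "connected C" "C \<subseteq> fixed_set act H" and pq: "p \<in> C" "q \<in> C"
  shows "restrict (A p) (lie_algebra H) = restrict (A q) (lie_algebra H)"
proof -
  let ?f = "\<lambda>p. restrict (A p) (lie_algebra H)"
  have "?f constant_on C"
  proof (rule locally_constant_imp_constant[OF C(1)])
    fix a assume a: "a \<in> C"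
    have "locally (\<lambda>U. ?f constant_on U) (fixed_set act H)"
      using A H by (simp add: pointwise_assignment_def)
    then obtain U V where UV: "openin (top_of_set (fixed_set act H)) U" "?f constant_on V"
        "a \<in> U" "U \<subseteq> V"
      using a C(2) unfolding locally_def by (metis openin_subtopology_self subsetD)
    have "openin (top_of_set C) (C \<inter> U)"
      using UV(1) C(2) by (metis inf.absorb_iff2 inf_commute openin_subtopology_Int2 subtopology_subtopology)
    moreover have "\<forall>x\<in>C \<inter> U. ?f x = ?f a"
      using UV(2-4) unfolding constant_on_def by (metis IntD2 subsetD)
    ultimately show "\<exists>T. openin (top_of_set C) T \<and> a \<in> T \<and> (\<forall>x\<in>T. ?f x = ?f a)"
      using UV(3) a by blast
  qed
  then show ?thesis using pq by (auto simp: constant_on_def)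
qed

lemma polynomials_on_restrict: "f \<in> polynomials_on h \<Longrightarrow> restrict f h = f"
  by (auto simp: polynomials_on_def)

text \<open>The closure of a stratum \<open>Z\<close> is connected and lies in the closed fixed point set of the subtorus
  with Lie algebra \<open>isot q\<close>, so the restriction of the assignment to that Lie algebra is constant on
  it; at a point of \<open>Z\<close> the restriction loses nothing. This gives both the constancy on strata
  (for \<open>p \<in> Z\<close>) and the compatibility of the common values.\<close>
lemma assignment_restrict_closure:
  assumes A: "pointwise_assignment (torus I) act A" and Z: "Z \<in> strata"
    and p: "p \<in> closure Z" and q: "q \<in> Z"
  shows "A q = restrict (A p) (isot q)"
proof -
  let ?H = "exp_closure (stab q)"
  have H: "subtorus ?H (torus I)" by (rule subtorus_exp_closure[OF subgroup_stab])
  have h: "lie_algebra ?H = isot q"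
    by (simp add: lie_algebra_exp_closure[OF subgroup_stab closed_stab] isotropy_algebra_def)
  have "closed (fixed_set act ?H)"
    using closed_fixed_set H subgroup.subset unfolding subtorus_def by blast
  then have "closure Z \<subseteq> fixed_set act ?H"
    using fixed_by_isotropy_torus iso_on_stratum[OF Z q] by (intro closure_minimal) blast+
  from restrict_constant_on_connected[OF A H connected_imp_connected_closure[OF connected_stratum[OF Z]] this p]
  have "restrict (A p) (isot q) = restrict (A q) (isot q)"
    using q closure_subset h by auto
  also have "\<dots> = A q"
    using A by (simp add: pointwise_assignment_def polynomials_on_restrict)
  finally show ?thesis ..
qed

lemma assignment_constant_on_stratum:
  assumes A: "pointwise_assignment (torus I) act A" and Y: "Y \<in> strata" and "p \<in> Y" "q \<in> Y"
  shows "A p = A q"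
proof -
  have "A p = restrict (A q) (isot p)"
    using assignment_restrict_closure[OF A Y] assms closure_subset by blast
  also have "\<dots> = A q"
    using A iso_on_stratum[OF Y \<open>p \<in> Y\<close> \<open>q \<in> Y\<close>]
    by (simp add: pointwise_assignment_def polynomials_on_restrict)
  finally show ?thesis .
qed

lemma common_value_eq:
  assumes "pointwise_assignment (torus I) act A" "Y \<in> strata" "p \<in> Y"
  shows "common_value A Y = A p"
  unfolding common_value_def
proof (rule the_equality)
  show "\<forall>q\<in>Y. A q = A p"
    using assignment_constant_on_stratum[OF assms(1,2) _ assms(3)] by blast
  show "c = A p" if "\<forall>q\<in>Y. A q = c" for c
    using bspec[OF that assms(3)] by (rule sym)
qed

lemma stratum_assignment_common_value:
  assumes A: "pointwise_assignment (torus I) act A"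
  shows "stratum_assignment (torus I) act (common_value A)"
  unfolding stratum_assignment_def
proof (intro conjI ballI impI)
  fix Y assume Y: "Y \<in> strata"
  then obtain p where p: "p \<in> Y" using stratum_nonempty by blast
  show "common_value A Y \<in> polynomials_on (stratum_algebra (torus I) act Y)"
    using A by (simp add: common_value_eq[OF A Y p] stratum_algebra_eq[OF Y p]
        pointwise_assignment_def)
  fix Z assume Z: "Z \<in> strata" and YZ: "Y \<subseteq> closure Z"
  obtain q where q: "q \<in> Z" using stratum_nonempty Z by blast
  show "common_value A Z = restrict (common_value A Y) (stratum_algebra (torus I) act Z)"
    using assignment_restrict_closure[OF A Z _ q] YZ p
    by (auto simp: common_value_eq[OF A Y p] common_value_eq[OF A Z q] stratum_algebra_eq[OF Z q])
qed

end


section \<open>Closed subgroups of the torus and semicontinuity of isotropy\<close>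
lemma torus_exp_uminus_mem:
  assumes S: "subgroup S (torus I)" and "torus_exp v \<in> S" shows "torus_exp (- v) \<in> S"
  using subgroup.m_inv_closed[OF S assms(2)] inv_torus_exp[of v I] subgroup.subset[OF S] assms(2)
  by auto

lemma torus_exp_add_mem:
  assumes S: "subgroup S (torus I)" and "torus_exp v \<in> S" "torus_exp w \<in> S"
  shows "torus_exp (v + w) \<in> S"
  using subgroup.m_closed[OF S assms(2,3)] by (simp add: mult_torus torus_exp_add)

lemma torus_exp_int_mult_mem:
  assumes S: "subgroup S (torus I)" and v: "torus_exp v \<in> S"
  shows "torus_exp (of_int k *\<^sub>R v) \<in> S"
proof -
  have nat: "torus_exp (of_nat n *\<^sub>R v) \<in> S" for n
  proof (induction n)
    case 0
    then show ?case using subgroup.one_closed[OF S] by (simp add: torus_exp_0 one_torus)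
  next
    case (Suc n)
    then show ?case using torus_exp_add_mem[OF S v] by (simp add: scaleR_add_left)
  qed
  show ?thesis
  proof (cases k)
    case (nonneg n)
    then show ?thesis using nat by simp
  next
    case (neg n)
    then show ?thesis using torus_exp_uminus_mem[OF S nat[of "Suc n"]] 
      by (simp flip: scaleR_minus_left)
  qed
qed

text \<open>The preimage of a closed subgroup under the exponential map is a closed subgroup of the Lie algebra
  of the torus, and \<open>lie_algebra S\<close> is the largest linear space in it. In the orthogonal directions it
  is discrete: if nonzero elements \<open>X k\<close> tended to \<open>0\<close>, their integer multiples would fill up the
  line spanned by a limit \<open>l\<close> of their directions, so that \<open>l\<close> would lie in \<open>lie_algebra S\<close>.\<close>
lemma transverse_discrete:
  assumes S: "subgroup S (torus I)" and cl: "closed S"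
  obtains \<epsilon> where "\<epsilon> > 0"
    "\<And>x. \<forall>v\<in>lie_algebra S. orthogonal x v \<Longrightarrow> torus_exp x \<in> S \<Longrightarrow> norm x < \<epsilon> \<Longrightarrow> x = 0"
proof (rule ccontr)
  assume "\<not> thesis"
  with that have "\<exists>x. (\<forall>v\<in>lie_algebra S. orthogonal x v) \<and> torus_exp x \<in> S \<and> norm x < \<epsilon> \<and> x \<noteq> 0"
    if "\<epsilon> > 0" for \<epsilon> using that by blast
  then have "\<forall>k. \<exists>x. (\<forall>v\<in>lie_algebra S. orthogonal x v) \<and> torus_exp x \<in> S
      \<and> norm x < inverse (real (Suc k)) \<and> x \<noteq> 0"
    by simp
  then obtain X where X: "\<And>k v. v \<in> lie_algebra S \<Longrightarrow> orthogonal (X k) v"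
      "\<And>k. torus_exp (X k) \<in> S" "\<And>k. norm (X k) < inverse (real (Suc k))" "\<And>k. X k \<noteq> 0"
    by metis
  define u where "u k = X k /\<^sub>R norm (X k)" for k
  have "\<forall>k. u k \<in> sphere 0 1" using X(4) by (simp add: u_def)
  then obtain l r where l: "l \<in> sphere 0 1" "strict_mono r" "(u \<circ> r) \<longlonglongrightarrow> l"
    using compact_sphere[of "0 :: real ^ 'a" 1] unfolding compact_def by blast
  have X0: "(\<lambda>k. norm (X k)) \<longlonglongrightarrow> 0"
    by (rule tendsto_sandwich[OF _ _ tendsto_const LIMSEQ_inverse_real_of_nat])
      (use X(3) less_imp_le in \<open>auto intro!: always_eventually\<close>)
  have "l \<in> lie_algebra S"
    unfolding lie_algebra_def
  proof (intro CollectI allI)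
    fix s :: real
    \<comment> \<open>the integer multiple of \<open>X k\<close> next to \<open>s\<close> from below has signed length \<open>m k\<close>\<close>
    define m where "m k = of_int \<lfloor>s / norm (X k)\<rfloor> * norm (X k)" for k
    have "norm (m k - s) \<le> norm (X k)" for k
    proof -
      have n: "norm (X k) > 0" using X(4) by simp
      have "m k \<le> s / norm (X k) * norm (X k)" "(s / norm (X k) - 1) * norm (X k) \<le> m k"
        unfolding m_def by (intro mult_right_mono; simp; linarith?)+
      then show ?thesis using n by (simp add: left_diff_distrib)
    qed
    then have "(\<lambda>k. m k - s) \<longlonglongrightarrow> 0"
      by (intro Lim_null_comparison[OF _ X0]) simp
    then have "m \<longlonglongrightarrow> s" by (simp add: LIM_zero_iff)
    then have "(\<lambda>k. m (r k) *\<^sub>R u (r k)) \<longlonglongrightarrow> s *\<^sub>R l"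
      using l(2,3) by (intro tendsto_scaleR) (auto simp: o_def dest: LIMSEQ_subseq_LIMSEQ)
    moreover have "isCont torus_exp (s *\<^sub>R l)"
      using continuous_on_torus_exp[of UNIV "\<lambda>x :: real ^ 'a. x"]
      by (simp add: continuous_on_eq_continuous_at continuous_on_id)
    ultimately have "(\<lambda>k. torus_exp (m (r k) *\<^sub>R u (r k))) \<longlonglongrightarrow> torus_exp (s *\<^sub>R l)"
      using isCont_tendsto_compose by blast
    moreover have "m k *\<^sub>R u k = of_int \<lfloor>s / norm (X k)\<rfloor> *\<^sub>R X k" for k
      using X(4) by (simp add: m_def u_def)
    then have "torus_exp (m k *\<^sub>R u k) \<in> S" for k
      using torus_exp_int_mult_mem[OF S X(2)] by simp
    ultimately show "torus_exp (s *\<^sub>R l) \<in> S"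
      using closed_sequentially[OF cl, of "\<lambda>k. torus_exp (m (r k) *\<^sub>R u (r k))"] by blast
  qed
  then have "u k \<bullet> l = 0" for k using X(1)[of l k] by (simp add: u_def orthogonal_def)
  then have "(\<lambda>k. 0) \<longlonglongrightarrow> l \<bullet> l"
    using tendsto_inner[OF l(3) tendsto_const[of l]] by (simp add: o_def)
  then have "l \<bullet> l = 0" using LIMSEQ_unique tendsto_const by blast
  then show False using l(1) by simp
qed

text \<open>Simultaneous Dirichlet approximation, read in the torus: the kernel of the exponential map is
  \<open>2\<pi>\<close> times the integer lattice.\<close>
lemma approximate_multiple_by_period:
  fixes v :: "real ^ 'n"
  assumes "\<delta> > 0"
  obtains q u where "q > (0 :: int)" "torus_exp u = 1" "norm (of_int q *\<^sub>R v - u) < \<delta>"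
proof -
  define d where "d = real CARD('n)"
  have d: "d > 0" by (simp add: d_def)
  obtain N :: nat where N: "2 * pi * d / \<delta> < N" using reals_Archimedean2 by blast
  have N0: "N > 0"
  proof (rule ccontr)
    assume "\<not> N > 0"
    then have "2 * pi * d / \<delta> < 0" using N by simp
    moreover have "2 * pi * d / \<delta> > 0" using d assms by simp
    ultimately show False by simp
  qed
  obtain h :: "'n \<Rightarrow> nat" where h: "bij_betw h UNIV {0..<CARD('n)}"
    using ex_bij_betw_finite_nat[of "UNIV :: 'n set"] by auto
  obtain q p where qp: "0 < q"
      "\<And>i. i < CARD('n) \<Longrightarrow> \<bar>of_int q * (v $ inv_into UNIV h i / (2 * pi)) - of_int (p i)\<bar> < 1 / N"
    using Dirichlet_approx_simult[OF N0, of "CARD('n)" "\<lambda>i. v $ inv_into UNIV h i / (2 * pi)"] by metis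
  define u :: "real ^ 'n" where "u = (\<chi> i. 2 * pi * of_int (p (h i)))"
  have comp: "\<bar>(of_int q *\<^sub>R v - u) $ i\<bar> < 2 * pi / N" for i
  proof -
    have hi: "h i < CARD('n)" "inv_into UNIV h (h i) = i"
      using h by (auto simp: bij_betw_def inv_f_f)
    have "(of_int q *\<^sub>R v - u) $ i = 2 * pi * (of_int q * (v $ i / (2 * pi)) - of_int (p (h i)))"
      by (simp add: u_def algebra_simps)
    then have "\<bar>(of_int q *\<^sub>R v - u) $ i\<bar>
        = 2 * pi * \<bar>of_int q * (v $ i / (2 * pi)) - of_int (p (h i))\<bar>"
      by (simp add: abs_mult)
    also have "\<dots> < 2 * pi * (1 / N)"
      using qp(2)[OF hi(1)] hi(2) by (intro mult_strict_left_mono) auto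
    finally show ?thesis by simp
  qed
  have "norm (of_int q *\<^sub>R v - u) \<le> (\<Sum>i\<in>UNIV. \<bar>(of_int q *\<^sub>R v - u) $ i\<bar>)"
    by (rule norm_le_l1_cart)
  also have "\<dots> \<le> (\<Sum>i\<in>(UNIV :: 'n set). 2 * pi / N)"
    using comp by (intro sum_mono less_imp_le) auto
  also have "\<dots> = 2 * pi * d / N" by (simp add: d_def)
  also have "\<dots> < \<delta>" using N N0 assms by (simp add: field_simps)
  finally have "norm (of_int q *\<^sub>R v - u) < \<delta>" .
  moreover have "torus_exp u = 1"
    by (simp add: torus_exp_def u_def vec_eq_iff cis_multiple_2pi)
  ultimately show ?thesis using that qp(1) by blast
qed

text \<open>The Lie algebra of a closed subgroup is spanned by its periods, the vectors in the kernel of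
  \<open>torus_exp\<close>. For \<open>v\<close> in the Lie algebra some multiple \<open>q v\<close> is very close to a period \<open>u\<close>. The
  component of \<open>u\<close> orthogonal to the Lie algebra is as short as \<open>q v - u\<close> and exponentiates into
  \<open>S\<close>, so it vanishes by discreteness. Thus \<open>u / q\<close> is in the span of the periods and close to
  \<open>v\<close>. The periods generate circle subgroups, over which functions can be averaged.\<close>
lemma lie_algebra_rational:
  assumes S: "subgroup S (torus I)" and cl: "closed S"
  shows "span {u \<in> lie_algebra S. torus_exp u = 1} = lie_algebra S"
proof
  let ?Q = "{u \<in> lie_algebra S. torus_exp u = 1}"
  have sub: "subspace (lie_algebra S)" by (rule subspace_lie_algebra[OF S])
  then show "span ?Q \<subseteq> lie_algebra S" by (intro span_minimal) auto
  obtain \<epsilon> where \<epsilon>: "\<epsilon> > 0"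
    "\<And>x. \<forall>v\<in>lie_algebra S. orthogonal x v \<Longrightarrow> torus_exp x \<in> S \<Longrightarrow> norm x < \<epsilon> \<Longrightarrow> x = 0"
    using transverse_discrete[OF S cl] by blast
  show "lie_algebra S \<subseteq> span ?Q"
  proof
    fix v assume v: "v \<in> lie_algebra S"
    have "v \<in> closure (span ?Q)"
      unfolding closure_approachable
    proof (intro allI impI)
      fix e :: real assume e: "e > 0"
      obtain q u where qu: "q > (0 :: int)" "torus_exp u = 1" "norm (of_int q *\<^sub>R v - u) < min \<epsilon> e"
        using approximate_multiple_by_period[of "min \<epsilon> e" v] \<epsilon>(1) e by auto
      obtain y x where yx: "y \<in> span (lie_algebra S)"
          "\<And>w. w \<in> span (lie_algebra S) \<Longrightarrow> orthogonal x w" "u = y + x"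
        using orthogonal_subspace_decomp_exists by metis
      have y: "y \<in> lie_algebra S" using yx(1) sub span_eq_iff by metis
      have qv: "of_int q *\<^sub>R v \<in> lie_algebra S" using subspace_scale[OF sub v] .
      have "orthogonal x (of_int q *\<^sub>R v - y)"
        using yx(2) span_base subspace_diff[OF sub qv y] by blast
      then have "(norm (of_int q *\<^sub>R v - y + - x))\<^sup>2 = (norm (of_int q *\<^sub>R v - y))\<^sup>2 + (norm (- x))\<^sup>2"
        by (intro norm_add_Pythagorean) (simp add: orthogonal_def inner_commute)
      then have "(norm x)\<^sup>2 \<le> (norm (of_int q *\<^sub>R v - u))\<^sup>2"
        by (simp add: yx(3) algebra_simps)
      then have "norm x \<le> norm (of_int q *\<^sub>R v - u)" by (simp add: power2_le_iff_abs_le)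
      then have nx: "norm x < \<epsilon>" using qu(3) by simp
      have "torus_exp (u + - y) \<in> S"
        using subgroup.one_closed[OF S] torus_exp_uminus_mem[OF S lie_algebra_exp[OF y]] qu(2)
        by (intro torus_exp_add_mem[OF S]) (simp_all add: one_torus)
      then have "x = 0" using \<epsilon>(2)[OF _ _ nx] yx(2,3) span_base by force
      then have "u \<in> ?Q" using yx(3) y qu(2) by simp
      then have "(1 / of_int q) *\<^sub>R u \<in> span ?Q" by (intro span_mul span_base)
      moreover have "dist ((1 / of_int q) *\<^sub>R u) v < e"
      proof -
        have "(1 / of_int q) *\<^sub>R u - v = - ((1 / of_int q) *\<^sub>R (of_int q *\<^sub>R v - u))"
          using qu(1) by (simp add: algebra_simps)
        then have "dist ((1 / of_int q) *\<^sub>R u) v = norm (of_int q *\<^sub>R v - u) / of_int q"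
          using qu(1) by (simp add: dist_norm)
        also have "\<dots> \<le> norm (of_int q *\<^sub>R v - u)"
          using qu(1) by (simp add: divide_le_eq mult_left_le mult_le_cancel_left1)
        finally show ?thesis using qu(3) by simp
      qed
      ultimately show "\<exists>y\<in>span ?Q. dist y v < e" by blast
    qed
    then show "v \<in> span ?Q" using closed_span by (simp add: closure_closed)
  qed
qed

text \<open>Projection along a compact factor is a closed map.\<close>
lemma open_Collect_forall_compact:
  fixes D :: "('a::topological_space \<times> 'b::topological_space) set"
  assumes "compact K" and D: "closedin (top_of_set (K \<times> UNIV)) D"
  shows "open {y. \<forall>x\<in>K. (x, y) \<notin> D}"
proof -
  have "closed_map (prod_topology (top_of_set K) (euclidean :: 'b topology)) euclidean snd"
    using assms(1) by (intro Abstract_Topological_Spaces.closed_map_snd) (simp add: compact_space_subtopology)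
  moreover have "prod_topology (top_of_set K) (euclidean :: 'b topology) = top_of_set (K \<times> UNIV)"
    by (metis prod_topology_subtopology_eu subtopology_UNIV)
  ultimately have "closed (snd ` D)"
    using D by (simp add: closed_map_def)
  moreover have "{y. \<forall>x\<in>K. (x, y) \<notin> D} = - snd ` D"
    using closedin_subset[OF D] by force
  ultimately show ?thesis by (simp add: open_Compl)
qed

context torus_action
begin

lemma continuous_on_act_case:
  assumes "K \<subseteq> carrier (torus I)" shows "continuous_on (K \<times> UNIV) (\<lambda>(z, p). act z p)"
  by (rule continuous_on_subset[OF continuous_action]) (use assms in auto)

lemma open_forall_act_mem:
  assumes K: "compact K" "K \<subseteq> carrier (torus I)" and U: "open U"
  shows "open {p. \<forall>z\<in>K. act z p \<in> U}"
proof -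
  have "closedin (top_of_set (K \<times> UNIV)) (K \<times> UNIV \<inter> (\<lambda>(z, p). act z p) -` (- U))"
    using U by (intro continuous_closedin_preimage continuous_on_act_case K(2)) (simp add: closed_Compl)
  from open_Collect_forall_compact[OF K(1) this] show ?thesis
    by (rule back_subst[where P = "open"]) auto
qed

lemma open_forall_act_neq:
  assumes K: "compact K" "K \<subseteq> carrier (torus I)"
  shows "open {p. \<forall>z\<in>K. act z p \<noteq> p}"
proof -
  have "continuous_on (K \<times> UNIV) (\<lambda>zp. (case zp of (z, p) \<Rightarrow> act z p, snd zp))"
    by (intro continuous_on_Pair continuous_on_act_case K(2) continuous_intros)
  then have "closedin (top_of_set (K \<times> UNIV))
      (K \<times> UNIV \<inter> (\<lambda>zp. (case zp of (z, p) \<Rightarrow> act z p, snd zp)) -` {y. \<exists>x. y = (x, x)})"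
    using closed_diagonal by (rule continuous_closedin_preimage)
  from open_Collect_forall_compact[OF K(1) this] show ?thesis
    by (rule back_subst[where P = "open"]) auto
qed

text \<open>Isotropy algebras can only shrink nearby. If \<open>\<xi> = y + x\<close> is in \<open>isot q\<close>, with \<open>y \<in> isot p\<close> and
  \<open>x \<noteq> 0\<close> orthogonal to \<open>isot p\<close>, then \<open>q\<close> is fixed by \<open>exp (s \<xi>) = exp (s x) exp (s y)\<close>, where
  \<open>s\<close> can be chosen such that \<open>s x\<close> has length \<open>\<epsilon> / 2\<close>. All elements of this shape form a compact set
  \<open>K\<close> that does not meet the stabilizer of \<open>p\<close>, by the discreteness in orthogonal directions; so
  no element of \<open>K\<close> fixes a point near \<open>p\<close>.\<close>
lemma iso_upper_semicontinuous: "\<exists>U. open U \<and> p \<in> U \<and> (\<forall>q\<in>U. isot q \<subseteq> isot p)"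
proof -
  obtain \<epsilon> where \<epsilon>: "\<epsilon> > 0"
    "\<And>x. \<forall>v\<in>isot p. orthogonal x v \<Longrightarrow> torus_exp x \<in> stab p \<Longrightarrow> norm x < \<epsilon> \<Longrightarrow> x = 0"
    using transverse_discrete[OF subgroup_stab[of p] closed_stab] unfolding isotropy_algebra_def by blast
  define P where "P = {x. \<forall>v\<in>isot p. orthogonal x v} \<inter> sphere 0 (\<epsilon> / 2)"
  define K where "K = carrier (torus I) \<inter> (\<lambda>(x, w). torus_exp x * w) ` (P \<times> stab p)"
  have "closed {x. \<forall>v\<in>isot p. orthogonal x v}"
    unfolding orthogonal_def Ball_def
    by (intro closed_Collect_all closed_Collect_imp closed_Collect_eq continuous_intros) simp
  then have "compact P" unfolding P_def by (intro closed_Int_compact) auto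
  moreover have "compact (stab p)"
    using compact_Int_closed[OF compact_torus closed_stab, of I p] subgroup.subset[OF subgroup_stab]
    by (simp add: Int_absorb1)
  ultimately have K: "compact K" unfolding K_def
    by (intro compact_Int_closed[OF compact_torus] compact_imp_closed compact_continuous_image
        compact_Times) (auto simp: case_prod_unfold intro!: continuous_intros)
  have "act z p \<noteq> p" if z: "z \<in> K" for z
  proof
    assume fixed: "act z p = p"
    obtain x w where xw: "x \<in> P" "w \<in> stab p" "z = torus_exp x * w" "z \<in> carrier (torus I)"
      using z by (auto simp: K_def)
    have "z \<otimes>\<^bsub>torus I\<^esub> inv\<^bsub>torus I\<^esub> w \<in> stab p"
      using fixed xw by (intro subgroup.m_closed[OF subgroup_stab] subgroup.m_inv_closed[OF subgroup_stab])
        (auto simp: stab_iff)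
    moreover have "z \<otimes>\<^bsub>torus I\<^esub> inv\<^bsub>torus I\<^esub> w = torus_exp x"
      using xw(2,3) group.r_inv[OF group_torus, of w I]
      by (simp add: mult_torus one_torus mult.assoc stab_iff)
    ultimately have "x = 0" using \<epsilon> xw(1) by (auto simp: P_def)
    then show False using xw(1) \<epsilon>(1) by (simp add: P_def)
  qed
  moreover have "isot q \<subseteq> isot p" if q: "\<forall>z\<in>K. act z q \<noteq> q" for q
  proof
    fix \<xi> assume \<xi>: "\<xi> \<in> isot q"
    obtain y x where yx: "y \<in> span (isot p)" "\<And>w. w \<in> span (isot p) \<Longrightarrow> orthogonal x w" "\<xi> = y + x"
      using orthogonal_subspace_decomp_exists by metis
    have y: "y \<in> isot p" using yx(1) subspace_iso span_eq_iff by metis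
    have "x = 0"
    proof (rule ccontr)
      assume x: "x \<noteq> 0"
      define s where "s = \<epsilon> / 2 / norm x"
      have st: "torus_exp (s *\<^sub>R \<xi>) \<in> stab q" using \<xi> by (simp add: iso_iff)
      have "s *\<^sub>R x \<in> P"
        using x \<epsilon>(1) yx(2) span_base by (auto simp: P_def s_def orthogonal_clauses)
      moreover have "torus_exp (s *\<^sub>R y) \<in> stab p" using y by (simp add: iso_iff)
      moreover have "torus_exp (s *\<^sub>R \<xi>) = torus_exp (s *\<^sub>R x) * torus_exp (s *\<^sub>R y)"
        by (simp add: yx(3) scaleR_add_right add.commute flip: torus_exp_add)
      ultimately have "torus_exp (s *\<^sub>R \<xi>) \<in> K"
        using st unfolding K_def by (force simp: stab_iff)
      then show False using q st by (auto simp: stab_iff)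
    qed
    then show "\<xi> \<in> isot p" using yx(3) y by simp
  qed
  ultimately show ?thesis
    using open_forall_act_neq[OF K] by (intro exI[of _ "{p. \<forall>z\<in>K. act z p \<noteq> p}"]) (auto simp: K_def)
qed

end


section \<open>Linearization of an action near a fixed point\<close>

text \<open>The invariance of the averages below under translation in the circle.\<close>
lemma integral_periodic_shift:
  fixes f :: "real \<Rightarrow> 'a::euclidean_space"
  assumes f: "continuous_on UNIV f" and per: "\<And>t. f (t + 1) = f t"
  shows "integral {0..1} (\<lambda>t. f (t + s)) = integral {0..1} f"
proof -
  have int: "f integrable_on {a..b}" if "continuous_on UNIV f" for f :: "real \<Rightarrow> 'a" and a b
    by (intro integrable_continuous_interval continuous_on_subset[OF that]) simp
  have shift: "integral {a..b} (\<lambda>t. f (t + c)) = integral {a + c..b + c} f" for a b c and f :: "real \<Rightarrow> 'a"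
    using integral_shift_Icc_real[of a b f c] by (simp add: o_def add.commute)
  have *: "integral {0..1} (\<lambda>t. f (t + s)) = integral {0..1} f"
    if f: "continuous_on UNIV f" and per: "\<And>t. f (t + 1) = f t" and s: "s \<ge> 0"
    for f :: "real \<Rightarrow> 'a" and s
  proof -
    have "integral {0..s} f + integral {s..s + 1} f = integral {0..s + 1} f"
      using s by (intro Henstock_Kurzweil_Integration.integral_combine int[OF f]) auto
    moreover have "integral {0..1} f + integral {1..s + 1} f = integral {0..s + 1} f"
      using s by (intro Henstock_Kurzweil_Integration.integral_combine int[OF f]) auto
    moreover have "integral {1..s + 1} f = integral {0..s} f"
      using shift[of 0 s f 1] by (simp add: per)
    ultimately have "integral {s..s + 1} f = integral {0..1} f"
      by (metis add.commute add_left_cancel)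
    then show ?thesis using shift[of 0 1 f s] by (simp add: add.commute)
  qed
  show ?thesis
  proof (cases "s \<ge> 0")
    case True
    then show ?thesis using *[OF f per] by blast
  next
    case False
    have "integral {0..1} (\<lambda>t. f (t + - s + s)) = integral {0..1} (\<lambda>t. f (t + s))"
    proof (rule *[of "\<lambda>t. f (t + s)" "- s"])
      show "continuous_on UNIV (\<lambda>t. f (t + s))"
        by (rule continuous_on_compose2[OF f]) (auto intro!: continuous_intros)
      show "f (t + 1 + s) = f (t + s)" for t using per[of "t + s"] by (simp add: ac_simps)
    qed (use False in simp)
    then show ?thesis by simp
  qed
qed

text \<open>An action of the additive group \<open>h\<close> by \<open>C\<^sup>1\<close> maps on an open set, with a fixed point \<open>y0\<close>. In the
  application \<open>h\<close> is an isotropy algebra, which acts through the exponential map in a chart. Working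
  with \<open>h\<close> instead of the isotropy group makes the parameter space linear.\<close>

locale C1_action =
  fixes h :: "'v::euclidean_space set" and \<Omega> :: "'e::euclidean_space set"
    and G :: "'v \<Rightarrow> 'e \<Rightarrow> 'e" and G' :: "'v \<Rightarrow> 'e \<Rightarrow> 'e \<Rightarrow>\<^sub>L 'e" and y0 :: 'e
  assumes subspace_h: "subspace h" and open_domain: "open \<Omega>" and base: "y0 \<in> \<Omega>"
    and G_closed: "\<xi> \<in> h \<Longrightarrow> y \<in> \<Omega> \<Longrightarrow> G \<xi> y \<in> \<Omega>"
    and G_0: "y \<in> \<Omega> \<Longrightarrow> G 0 y = y"
    and G_add: "\<xi> \<in> h \<Longrightarrow> \<eta> \<in> h \<Longrightarrow> y \<in> \<Omega> \<Longrightarrow> G (\<xi> + \<eta>) y = G \<xi> (G \<eta> y)"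
    and G_base: "\<xi> \<in> h \<Longrightarrow> G \<xi> y0 = y0"
    and G_deriv: "\<xi> \<in> h \<Longrightarrow> y \<in> \<Omega> \<Longrightarrow> (G \<xi> has_derivative G' \<xi> y) (at y)"
    and continuous_G: "continuous_on (h \<times> \<Omega>) (\<lambda>(\<xi>, y). G \<xi> y)"
    and continuous_G': "continuous_on (h \<times> \<Omega>) (\<lambda>(\<xi>, y). G' \<xi> y)"
begin

text \<open>The isotropy representation of \<open>h\<close> on the tangent space at \<open>y0\<close>.\<close>

definition D :: "'v \<Rightarrow> 'e \<Rightarrow>\<^sub>L 'e" where "D \<xi> = G' \<xi> y0"

lemma scale_h: "\<xi> \<in> h \<Longrightarrow> t *\<^sub>R \<xi> \<in> h"
  using subspace_scale[OF subspace_h] .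

lemma D_unique:
  assumes "\<xi> \<in> h" "(f has_derivative f') (at y0)" "\<And>y. y \<in> \<Omega> \<Longrightarrow> f y = G \<xi> y"
  shows "blinfun_apply (D \<xi>) = f'"
proof -
  have "(f has_derivative D \<xi>) (at y0)"
    unfolding D_def using has_derivative_transform_within_open[OF G_deriv[OF assms(1) base] open_domain base]
      assms(3) by metis
  then show ?thesis using has_derivative_unique assms(2) by blast
qed

lemma D_period:
  assumes "\<xi> \<in> h" "\<And>y. y \<in> \<Omega> \<Longrightarrow> G \<xi> y = y" shows "D \<xi> = id_blinfun"
  using D_unique[OF assms(1) has_derivative_ident] assms(2)
  by (auto intro!: blinfun_eqI)

lemma D_0: "D 0 = id_blinfun"
  by (rule D_period) (auto simp: G_0 subspace_0[OF subspace_h])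

lemma D_add:
  assumes "\<xi> \<in> h" "\<eta> \<in> h" shows "D (\<xi> + \<eta>) = D \<xi> o\<^sub>L D \<eta>"
proof -
  have "((\<lambda>y. G \<xi> (G \<eta> y)) has_derivative (\<lambda>v. D \<xi> (D \<eta> v))) (at y0)"
    using has_derivative_compose[OF G_deriv[OF assms(2) base], of "G \<xi>" "D \<xi>"]
      G_deriv[OF assms(1) base] G_base[OF assms(2)] by (simp add: D_def)
  from D_unique[OF subspace_add[OF subspace_h assms] this] show ?thesis
    using G_add[OF assms] by (auto intro!: blinfun_eqI)
qed

lemma D_uminus_apply: assumes "\<xi> \<in> h" shows "D (- \<xi>) (D \<xi> v) = v"
  using D_add[OF subspace_neg[OF subspace_h assms] assms] D_0
  by (metis add.left_inverse blinfun_apply_blinfun_compose blinfun_apply_id_blinfun id_apply)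

lemma continuous_on_G:
  assumes "continuous_on S f" "continuous_on S g" "f ` S \<subseteq> h" "g ` S \<subseteq> \<Omega>"
  shows "continuous_on S (\<lambda>x. G (f x) (g x))" "continuous_on S (\<lambda>x. G' (f x) (g x))"
proof -
  have fg: "continuous_on S (\<lambda>x. (f x, g x))" "(\<lambda>x. (f x, g x)) ` S \<subseteq> h \<times> \<Omega>"
    using assms by (auto intro: continuous_on_Pair)
  show "continuous_on S (\<lambda>x. G (f x) (g x))" "continuous_on S (\<lambda>x. G' (f x) (g x))"
    using continuous_on_compose2[OF continuous_G fg] continuous_on_compose2[OF continuous_G' fg]
    by simp_all
qed

lemma continuous_on_D:
  assumes "continuous_on S f" "f ` S \<subseteq> h" shows "continuous_on S (\<lambda>x. D (f x))"
  unfolding D_def by (rule continuous_on_G(2)) (use assms base in auto)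

definition C1_chart :: "('e \<Rightarrow> 'e) \<Rightarrow> ('e \<Rightarrow> 'e \<Rightarrow>\<^sub>L 'e) \<Rightarrow> bool" where
  "C1_chart F F' \<longleftrightarrow> (\<forall>y\<in>\<Omega>. (F has_derivative F' y) (at y)) \<and> continuous_on \<Omega> F' \<and>
     F y0 = 0 \<and> F' y0 = id_blinfun"

definition equivariant :: "('e \<Rightarrow> 'e) \<Rightarrow> 'v \<Rightarrow> bool" where
  "equivariant F \<xi> \<longleftrightarrow> (\<forall>y\<in>\<Omega>. F (G \<xi> y) = D \<xi> (F y))"

text \<open>A vector \<open>b\<close> that acts as the identity generates a circle action; this is the average over that
  circle of the pulled back and straightened maps \<open>D (- t b) \<circ> F \<circ> G (t b)\<close>.\<close>

definition average :: "'v \<Rightarrow> ('e \<Rightarrow> 'e) \<Rightarrow> 'e \<Rightarrow> 'e" where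
  "average b F y = integral {0..1} (\<lambda>t. D (- (t *\<^sub>R b)) (F (G (t *\<^sub>R b) y)))"

lemma continuous_on_chart: "C1_chart F F' \<Longrightarrow> continuous_on \<Omega> F"
  unfolding C1_chart_def
  by (metis continuous_at_imp_continuous_on has_derivative_continuous)

lemma continuous_on_integrand:
  assumes F: "C1_chart F F'" and b: "b \<in> h" and y: "y \<in> \<Omega>"
  shows "continuous_on S (\<lambda>t. D (- (t *\<^sub>R b)) (F (G (t *\<^sub>R b) y)))"
proof (intro bounded_bilinear.continuous_on[OF bounded_bilinear_blinfun_apply] continuous_on_D
    continuous_on_compose2[OF continuous_on_chart[OF F]] continuous_on_G continuous_intros)
qed (use b y scale_h G_closed subspace_neg[OF subspace_h] in auto)

text \<open>Differentiation under the integral sign. The differential at \<open>y0\<close> remains the identity because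
  \<open>D (- t b)\<close> cancels the differential of \<open>G (t b)\<close>.\<close>
lemma average_chart:
  assumes F: "C1_chart F F'" and b: "b \<in> h"
  shows "\<exists>F'. C1_chart (average b F) F'"
proof -
  define u' where "u' y t = D (- (t *\<^sub>R b)) o\<^sub>L (F' (G (t *\<^sub>R b) y) o\<^sub>L G' (t *\<^sub>R b) y)" for y and t :: real
  have tb: "t *\<^sub>R b \<in> h" "- (t *\<^sub>R b) \<in> h" for t
    using scale_h[OF b] subspace_neg[OF subspace_h] by auto
  have F': "\<And>y. y \<in> \<Omega> \<Longrightarrow> (F has_derivative F' y) (at y)" "continuous_on \<Omega> F'"
      "F y0 = 0" "F' y0 = id_blinfun"
    using F by (auto simp: C1_chart_def)
  have cont: "continuous_on (\<Omega> \<times> cbox 0 1) (\<lambda>(y, t). u' y t)"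
    unfolding u'_def case_prod_unfold
  proof (intro bounded_bilinear.continuous_on[OF bounded_bilinear_blinfun_compose] continuous_on_D
      continuous_on_compose2[OF F'(2)] continuous_on_G continuous_intros)
  qed (use tb G_closed in auto)
  have deriv_u: "((\<lambda>y. D (- (t *\<^sub>R b)) (F (G (t *\<^sub>R b) y))) has_derivative u' y t) (at y)"
    if y: "y \<in> \<Omega>" for y t
  proof -
    have "((\<lambda>y. F (G (t *\<^sub>R b) y)) has_derivative (\<lambda>v. F' (G (t *\<^sub>R b) y) (G' (t *\<^sub>R b) y v))) (at y)"
      by (rule has_derivative_compose[OF G_deriv[OF tb(1) y] F'(1)[OF G_closed[OF tb(1) y]]])
    from bounded_linear.has_derivative[OF blinfun.bounded_linear_right this, of "D (- (t *\<^sub>R b))"]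
    moreover have "blinfun_apply (u' y t)
        = (\<lambda>v. D (- (t *\<^sub>R b)) (F' (G (t *\<^sub>R b) y) (G' (t *\<^sub>R b) y v)))"
      by (simp add: u'_def fun_eq_iff)
    ultimately show ?thesis by simp
  qed
  have "(average b F has_derivative integral (cbox 0 1) (u' y)) (at y)" if y: "y \<in> \<Omega>" for y
  proof -
    obtain r where r: "r > 0" "ball y r \<subseteq> \<Omega>" using open_domain y openE by blast
    have "((\<lambda>y. integral (cbox 0 1) (\<lambda>t. D (- (t *\<^sub>R b)) (F (G (t *\<^sub>R b) y))))
        has_derivative integral (cbox 0 1) (u' y)) (at y within ball y r)"
    proof (rule leibniz_rule)
      show "continuous_on (ball y r \<times> cbox 0 1) (\<lambda>(x, t). u' x t)"
        by (rule continuous_on_subset[OF cont]) (use r in auto)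
      show "(\<lambda>t. D (- (t *\<^sub>R b)) (F (G (t *\<^sub>R b) x))) integrable_on cbox 0 1" if "x \<in> ball y r" for x
        using that r by (intro integrable_continuous continuous_on_integrand[OF F b]) auto
      show "((\<lambda>y. D (- (t *\<^sub>R b)) (F (G (t *\<^sub>R b) y))) has_derivative u' x t) (at x within ball y r)"
        if "x \<in> ball y r" for x t
        using r(2) that deriv_u by (blast intro: has_derivative_at_withinI)
    qed (use r(1) in auto)
    then show ?thesis
      using r(1) by (simp add: average_def[abs_def] at_within_open[of y "ball y r"])
  qed
  moreover have "continuous_on \<Omega> (\<lambda>y. integral (cbox 0 1) (u' y))"
    by (rule integral_continuous_on_param[OF cont])
  moreover have "average b F y0 = 0"
    using tb by (simp add: average_def G_base F'(3) blinfun.zero_right)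
  moreover have "integral (cbox 0 1) (u' y0) = id_blinfun"
  proof -
    have "u' y0 t = id_blinfun" for t
      using D_uminus_apply[OF tb(1)] G_base[OF tb(1)]
      by (auto simp: u'_def F'(4) D_def[symmetric] intro!: blinfun_eqI)
    then have "u' y0 = (\<lambda>t. id_blinfun)" by (rule ext)
    then have "integral (cbox 0 1) (u' y0) = measure lborel (cbox 0 (1 :: real)) *\<^sub>R id_blinfun"
      by (simp only: integral_const)
    moreover have "measure lborel (cbox 0 (1 :: real)) = 1" by simp
    ultimately show ?thesis by (simp only: scaleR_one)
  qed
  ultimately show ?thesis
    unfolding C1_chart_def by (intro exI[of _ "\<lambda>y. integral (cbox 0 1) (u' y)"]) simp
qed

text \<open>Since \<open>h\<close> is commutative, averaging over one circle preserves equivariance under the others; so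
  the average over a torus can be taken one circle at a time.\<close>
lemma average_equivariant_commuting:
  assumes F: "C1_chart F F'" and b: "b \<in> h" and \<xi>: "\<xi> \<in> h" "equivariant F \<xi>"
  shows "equivariant (average b F) \<xi>"
  unfolding equivariant_def
proof
  fix y assume y: "y \<in> \<Omega>"
  have tb: "t *\<^sub>R b \<in> h" "- (t *\<^sub>R b) \<in> h" for t
    using scale_h[OF b] subspace_neg[OF subspace_h] by auto
  have "D (- (t *\<^sub>R b)) (F (G (t *\<^sub>R b) (G \<xi> y))) = D \<xi> (D (- (t *\<^sub>R b)) (F (G (t *\<^sub>R b) y)))" for t
  proof -
    have "G (t *\<^sub>R b) (G \<xi> y) = G \<xi> (G (t *\<^sub>R b) y)"
      using G_add[OF tb(1) \<xi>(1) y] G_add[OF \<xi>(1) tb(1) y] by (simp add: add.commute)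
    moreover have "D (- (t *\<^sub>R b)) (D \<xi> v) = D \<xi> (D (- (t *\<^sub>R b)) v)" for v
      using D_add[OF tb(2) \<xi>(1)] D_add[OF \<xi>(1) tb(2)]
      by (metis add.commute blinfun_apply_blinfun_compose)
    ultimately show ?thesis
      using \<xi>(2) G_closed[OF tb(1) y] by (simp add: equivariant_def)
  qed
  then have "average b F (G \<xi> y) = integral {0..1} (D \<xi> \<circ> (\<lambda>t. D (- (t *\<^sub>R b)) (F (G (t *\<^sub>R b) y))))"
    by (simp add: average_def o_def)
  also have "\<dots> = D \<xi> (average b F y)"
    unfolding average_def
    by (intro integral_linear integrable_continuous_interval continuous_on_integrand[OF F b y]
        blinfun.bounded_linear_right)
  finally show "average b F (G \<xi> y) = D \<xi> (average b F y)" .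
qed

text \<open>Moving the argument by \<open>s b\<close> shifts the periodic integrand by \<open>s\<close> and applies \<open>D (s b)\<close>.\<close>
lemma average_equivariant_circle:
  assumes F: "C1_chart F F'" and b: "b \<in> h" and per: "\<And>y. y \<in> \<Omega> \<Longrightarrow> G b y = y"
  shows "equivariant (average b F) (s *\<^sub>R b)"
  unfolding equivariant_def
proof
  fix y assume y: "y \<in> \<Omega>"
  have tb: "t *\<^sub>R b \<in> h" "- (t *\<^sub>R b) \<in> h" for t
    using scale_h[OF b] subspace_neg[OF subspace_h] by auto
  define f where "f t = D (- (t *\<^sub>R b)) (F (G (t *\<^sub>R b) y))" for t
  have Db: "D b = id_blinfun" using D_period[OF b per] .
  then have Dmb: "D (- b) v = v" for v using D_uminus_apply[OF b, of v] by simp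
  have "f (t + 1) = f t" for t
  proof -
    have "G ((t + 1) *\<^sub>R b) y = G (t *\<^sub>R b) y"
      using G_add[OF tb(1) b y] per[OF y] by (simp add: scaleR_add_left)
    moreover have "D (- ((t + 1) *\<^sub>R b)) v = D (- (t *\<^sub>R b)) v" for v
      using D_add[OF tb(2)[of t] subspace_neg[OF subspace_h b]] Dmb[of v]
      by (simp add: scaleR_add_left)
    ultimately show ?thesis by (simp add: f_def)
  qed
  moreover have "continuous_on UNIV f"
    unfolding f_def by (rule continuous_on_integrand[OF F b y])
  ultimately have "integral {0..1} (\<lambda>t. f (t + s)) = integral {0..1} f"
    by (intro integral_periodic_shift)
  then have avg: "integral {0..1} (\<lambda>t. f (t + s)) = average b F y"
    by (simp add: average_def f_def[abs_def])
  have "D (- (t *\<^sub>R b)) (F (G (t *\<^sub>R b) (G (s *\<^sub>R b) y))) = D (s *\<^sub>R b) (f (t + s))" for t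
  proof -
    have "D (s *\<^sub>R b) (D (- ((t + s) *\<^sub>R b)) v) = D (- (t *\<^sub>R b)) v" for v
      using D_add[OF tb(1)[of s] tb(2)[of "t + s"]] by (simp add: scaleR_add_left)
    moreover have "G (t *\<^sub>R b) (G (s *\<^sub>R b) y) = G ((t + s) *\<^sub>R b) y"
      using G_add[OF tb(1)[of t] tb(1)[of s] y] by (simp add: scaleR_add_left)
    ultimately show ?thesis by (simp add: f_def)
  qed
  then have "average b F (G (s *\<^sub>R b) y) = integral {0..1} (D (s *\<^sub>R b) \<circ> (\<lambda>t. f (t + s)))"
    by (simp add: average_def o_def)
  also have "\<dots> = D (s *\<^sub>R b) (integral {0..1} (\<lambda>t. f (t + s)))"
    by (intro integral_linear integrable_continuous_interval blinfun.bounded_linear_right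
        continuous_on_compose2[OF \<open>continuous_on UNIV f\<close>] continuous_intros) simp
  finally show "average b F (G (s *\<^sub>R b) y) = D (s *\<^sub>R b) (average b F y)" by (simp add: avg)
qed

text \<open>The induction starts from a translation of the identity and averages it over one circle after
  another.\<close>
lemma equivariant_chart_finite:
  assumes "finite B" "B \<subseteq> {b \<in> h. \<forall>y\<in>\<Omega>. G b y = y}"
  shows "\<exists>F F'. C1_chart F F' \<and> (\<forall>b\<in>B. \<forall>s. equivariant F (s *\<^sub>R b))"
  using assms
proof (induction B)
  case empty
  have "C1_chart (\<lambda>y. y - y0) (\<lambda>y. id_blinfun)"
    unfolding C1_chart_def by (auto intro!: derivative_eq_intros)
  then show ?case by blast
next
  case (insert b B)
  then obtain F F' where F: "C1_chart F F'" "\<forall>b\<in>B. \<forall>s. equivariant F (s *\<^sub>R b)" by auto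
  have b: "b \<in> h" "\<And>y. y \<in> \<Omega> \<Longrightarrow> G b y = y" and B: "B \<subseteq> h" using insert.prems by auto
  obtain F2' where "C1_chart (average b F) F2'" using average_chart[OF F(1) b(1)] by blast
  moreover have "equivariant (average b F) (s *\<^sub>R c)" if "c \<in> B" for c s
    using average_equivariant_commuting[OF F(1) b(1)] F(2) that B scale_h by blast
  moreover have "equivariant (average b F) (s *\<^sub>R b)" for s
    by (rule average_equivariant_circle[OF F(1) b])
  ultimately show ?case by blast
qed

lemma equivariant_chart:
  assumes h: "span {b \<in> h. \<forall>y\<in>\<Omega>. G b y = y} = h"
  obtains F F' where "C1_chart F F'" "\<And>\<xi>. \<xi> \<in> h \<Longrightarrow> equivariant F \<xi>"
proof -
  let ?P = "{b \<in> h. \<forall>y\<in>\<Omega>. G b y = y}"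
  obtain B where B: "B \<subseteq> ?P" "independent B" "?P \<subseteq> span B"
    by (rule maximal_independent_subset)
  obtain F F' where F: "C1_chart F F'" "\<forall>b\<in>B. \<forall>s. equivariant F (s *\<^sub>R b)"
    using equivariant_chart_finite[OF finiteI_independent[OF B(2)] B(1)] by blast
  have "\<xi> \<in> h \<and> equivariant F \<xi>" if "\<xi> \<in> span B" for \<xi>
    using that
  proof (induction rule: span_induct_alt)
    case base
    show ?case using subspace_0[OF subspace_h] by (simp add: equivariant_def G_0 D_0)
  next
    case (step c x y)
    have cx: "c *\<^sub>R x \<in> h" using step.hyps(1) B(1) scale_h by blast
    have "F (G (c *\<^sub>R x + y) z) = D (c *\<^sub>R x + y) (F z)" if z: "z \<in> \<Omega>" for z
      using step F(2) z cx by (simp add: equivariant_def G_add G_closed D_add)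
    then show ?case using cx step subspace_add[OF subspace_h] by (simp add: equivariant_def)
  qed
  moreover have "h \<subseteq> span B" using h span_mono[OF B(3)] by (simp add: span_span)
  ultimately show ?thesis using that F(1) by blast
qed

text \<open>Bochner's linearization, in the form that is used for isotropy algebras: an equivariant chart
  with invertible differential is a local homeomorphism by the inverse function theorem. Equivariance
  shows that a one-parameter group that fixes \<open>y\<close> also fixes \<open>\<Phi> y\<close>. Conversely, if it fixes
  \<open>\<Phi> y\<close>, then \<open>\<Phi>\<close> maps the whole orbit of \<open>y\<close> to \<open>\<Phi> y\<close>. The orbit may leave the set \<open>W\<close>,
  on which \<open>\<Phi>\<close> is injective, but by injectivity it cannot move while it is in \<open>W\<close>: the times at which
  it is at \<open>y\<close> form a set that is open as well as closed, hence all of \<open>\<real>\<close>.\<close>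
lemma linearization:
  assumes h: "span {b \<in> h. \<forall>y\<in>\<Omega>. G b y = y} = h"
  obtains W r \<Phi> \<Psi> where "open W" "y0 \<in> W" "W \<subseteq> \<Omega>" "homeomorphism W (ball 0 r) \<Phi> \<Psi>"
    "\<And>\<xi> y. \<xi> \<in> h \<Longrightarrow> y \<in> W \<Longrightarrow>
       (\<forall>t. G (t *\<^sub>R \<xi>) y = y) \<longleftrightarrow> (\<forall>t. D (t *\<^sub>R \<xi>) (\<Phi> y) = \<Phi> y)"
proof -
  obtain F F' where F: "C1_chart F F'" and eq: "\<And>\<xi>. \<xi> \<in> h \<Longrightarrow> equivariant F \<xi>"
    using equivariant_chart[OF h] by blast
  obtain U V \<Psi> where U: "open U" "U \<subseteq> \<Omega>" "y0 \<in> U" "open V" "F y0 \<in> V" "homeomorphism U V F \<Psi>"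
  proof (rule inverse_function_theorem[OF open_domain, of F F' y0 id_blinfun])
    show "id_blinfun o\<^sub>L F' y0 = id_blinfun"
      using F by (auto simp: C1_chart_def intro: blinfun_eqI)
  qed (use F base in \<open>auto simp: C1_chart_def\<close>)
  have F0: "F y0 = 0" using F by (simp add: C1_chart_def)
  obtain r where r: "r > 0" "ball 0 r \<subseteq> V" using U(4,5) F0 openE by metis
  define W where "W = \<Psi> ` ball 0 r"
  have W: "homeomorphism W (ball 0 r) F \<Psi>"
    unfolding W_def
  proof (rule homeomorphism_of_subsets[OF U(6) _ r(2)])
    show "\<Psi> ` ball 0 r \<subseteq> U" using r(2) homeomorphism_image2[OF U(6)] by blast
    have "F (\<Psi> z) = z" if "z \<in> ball 0 r" for z
      using that r(2) homeomorphism_apply2[OF U(6)] by blast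
    then show "F ` \<Psi> ` ball 0 r = ball 0 r" by (simp add: image_image)
  qed
  have "W = U \<inter> F -` ball 0 r"
  proof (intro subset_antisym subsetI)
    fix y assume "y \<in> U \<inter> F -` ball 0 r"
    then show "y \<in> W" using homeomorphism_apply1[OF U(6)] by (metis Int_iff W_def image_eqI vimageD)
  next
    fix y assume y: "y \<in> W"
    then have "F y \<in> ball 0 r" using homeomorphism_image1[OF W] by blast
    moreover have "y \<in> U" using y r(2) homeomorphism_image2[OF U(6)] by (auto simp: W_def)
    ultimately show "y \<in> U \<inter> F -` ball 0 r" by simp
  qed
  then have oW: "open W"
    using continuous_open_preimage[OF homeomorphism_cont1[OF U(6)] U(1) open_ball] by simp
  have WU: "W \<subseteq> U" using \<open>W = U \<inter> F -` ball 0 r\<close> by blast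
  show ?thesis
  proof
    show "open W" "homeomorphism W (ball 0 r) F \<Psi>" by fact+
    show "y0 \<in> W" using \<open>W = U \<inter> F -` ball 0 r\<close> U(3) F0 r(1) by simp
    show "W \<subseteq> \<Omega>" using WU U(2) by blast
    fix \<xi> y assume \<xi>: "\<xi> \<in> h" and y: "y \<in> W"
    have y\<Omega>: "y \<in> \<Omega>" using y WU U(2) by blast
    have FG: "F (G (t *\<^sub>R \<xi>) y) = D (t *\<^sub>R \<xi>) (F y)" for t
      using eq[OF scale_h[OF \<xi>]] y\<Omega> by (simp add: equivariant_def)
    show "(\<forall>t. G (t *\<^sub>R \<xi>) y = y) \<longleftrightarrow> (\<forall>t. D (t *\<^sub>R \<xi>) (F y) = F y)"
    proof
      assume "\<forall>t. G (t *\<^sub>R \<xi>) y = y"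
      then show "\<forall>t. D (t *\<^sub>R \<xi>) (F y) = F y" using FG by metis
    next
      assume D: "\<forall>t. D (t *\<^sub>R \<xi>) (F y) = F y"
      define c where "c t = G (t *\<^sub>R \<xi>) y" for t
      have cc: "continuous_on UNIV c"
        unfolding c_def
        by (rule continuous_on_G(1)) (use \<xi> y\<Omega> scale_h in \<open>auto intro!: continuous_intros\<close>)
      have "{t. c t = y} = c -` W"
      proof (rule Set.set_eqI, rule iffI)
        fix t assume "t \<in> c -` W"
        moreover have "F (c t) = F y" using FG D by (simp add: c_def)
        ultimately show "t \<in> {t. c t = y}"
          using y homeomorphism_apply1[OF W] by (metis mem_Collect_eq vimageD)
      qed (use y in auto)
      moreover have "open (c -` W)" using open_vimage[OF oW cc] .
      moreover have "closed {t. c t = y}" by (intro closed_Collect_eq cc continuous_on_const)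
      ultimately have "{t. c t = y} = {} \<or> {t. c t = y} = UNIV" using clopen by metis
      moreover have "c 0 = y" using G_0[OF y\<Omega>] by (simp add: c_def)
      ultimately show "\<forall>t. G (t *\<^sub>R \<xi>) y = y" unfolding c_def by blast
    qed
  qed
qed

text \<open>In the linear chart the isotropy algebra is constant along the half-open segment from a fixed point
  \<open>y'\<close> (excluded) to \<open>y\<close>: a linear map that fixes \<open>\<Phi> y'\<close> fixes \<open>\<Phi> y' + s (\<Phi> y - \<Phi> y')\<close> for
  some \<open>s \<noteq> 0\<close> if and only if it fixes \<open>\<Phi> y\<close>.\<close>
lemma conical_neighbourhood:
  assumes h: "span {b \<in> h. \<forall>y\<in>\<Omega>. G b y = y} = h"
  shows "\<exists>W. open W \<and> y0 \<in> W \<and> W \<subseteq> \<Omega> \<and>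
    (\<forall>y\<in>W. \<forall>y'\<in>W. (\<forall>\<xi>\<in>h. G \<xi> y' = y') \<longrightarrow>
       (\<exists>\<gamma>. continuous_on {0..1} \<gamma> \<and> \<gamma> ` {0..1} \<subseteq> W \<and> \<gamma> 0 = y' \<and> \<gamma> 1 = y \<and>
         (\<forall>s\<in>{0<..1::real}. \<forall>\<xi>\<in>h. (\<forall>t. G (t *\<^sub>R \<xi>) (\<gamma> s) = \<gamma> s) \<longleftrightarrow> (\<forall>t. G (t *\<^sub>R \<xi>) y = y))))"
proof -
  obtain W r \<Phi> \<Psi> where W: "open W" "y0 \<in> W" "W \<subseteq> \<Omega>" "homeomorphism W (ball 0 r) \<Phi> \<Psi>"
    and lin: "\<And>\<xi> y. \<xi> \<in> h \<Longrightarrow> y \<in> W \<Longrightarrow>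
       (\<forall>t. G (t *\<^sub>R \<xi>) y = y) \<longleftrightarrow> (\<forall>t. D (t *\<^sub>R \<xi>) (\<Phi> y) = \<Phi> y)"
    using linearization[OF h] by metis
  show ?thesis
  proof (intro exI[of _ W] conjI ballI impI W(1-3))
    fix y y' assume y: "y \<in> W" and y': "y' \<in> W" and fixed: "\<forall>\<xi>\<in>h. G \<xi> y' = y'"
    define l where "l s = \<Phi> y' + s *\<^sub>R (\<Phi> y - \<Phi> y')" for s
    have ball: "\<Phi> y \<in> ball 0 r" "\<Phi> y' \<in> ball 0 r"
      using y y' homeomorphism_image1[OF W(4)] by auto
    have l: "l s \<in> ball 0 r" if "s \<in> {0..1}" for s
      using convexD_alt[OF convex_ball ball(2,1), of s] that by (simp add: l_def algebra_simps)
    have \<Psi>l: "\<Psi> (l s) \<in> W" "\<Phi> (\<Psi> (l s)) = l s" if "s \<in> {0..1}" for s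
      using l[OF that] W(4) by (auto simp: homeomorphism_def)
    have "continuous_on {0..1} (\<lambda>s. \<Psi> (l s))"
      by (rule continuous_on_compose2[OF homeomorphism_cont2[OF W(4)]])
        (use l in \<open>auto simp: l_def intro!: continuous_intros\<close>)
    moreover have "\<Psi> (l 0) = y'" "\<Psi> (l 1) = y"
      using y y' homeomorphism_apply1[OF W(4)] by (auto simp: l_def)
    moreover have "(\<forall>t. G (t *\<^sub>R \<xi>) (\<Psi> (l s)) = \<Psi> (l s)) \<longleftrightarrow> (\<forall>t. G (t *\<^sub>R \<xi>) y = y)"
      if s: "s \<in> {0<..1}" and \<xi>: "\<xi> \<in> h" for s \<xi>
    proof -
      have s01: "s \<in> {0..1}" using s by auto
      have "\<forall>t. G (t *\<^sub>R \<xi>) y' = y'" using fixed scale_h[OF \<xi>] by blast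
      then have D': "D (t *\<^sub>R \<xi>) (\<Phi> y') = \<Phi> y'" for t using lin[OF \<xi> y'] by blast
      have "D (t *\<^sub>R \<xi>) (l s) = l s \<longleftrightarrow> D (t *\<^sub>R \<xi>) (\<Phi> y) = \<Phi> y" for t
        using s by (simp add: l_def blinfun.add_right blinfun.scaleR_right blinfun.diff_right D')
      then show ?thesis using lin[OF \<xi> \<Psi>l(1)[OF s01]] lin[OF \<xi> y] \<Psi>l(2)[OF s01] by simp
    qed
    ultimately show "\<exists>\<gamma>. continuous_on {0..1} \<gamma> \<and> \<gamma> ` {0..1} \<subseteq> W \<and> \<gamma> 0 = y' \<and> \<gamma> 1 = y \<and>
         (\<forall>s\<in>{0<..1::real}. \<forall>\<xi>\<in>h. (\<forall>t. G (t *\<^sub>R \<xi>) (\<gamma> s) = \<gamma> s) \<longleftrightarrow> (\<forall>t. G (t *\<^sub>R \<xi>) y = y))"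
      using \<Psi>l(1) by (intro exI[of _ "\<lambda>s. \<Psi> (l s)"]) auto
  qed
qed

end


section \<open>The frontier condition for infinitesimal strata\<close>

text \<open>The part of smoothness that the linearization uses: local \<open>C\<^sup>1\<close> extensions.\<close>
lemma smooth_onE:
  assumes "smooth_on S f" "x \<in> S"
  obtains U g g' where "open U" "x \<in> U" "\<And>y. y \<in> U \<Longrightarrow> (g has_derivative g' y) (at y)"
    "\<And>v. continuous_on U (\<lambda>y. g' y v)" "\<And>y. y \<in> S \<Longrightarrow> y \<in> U \<Longrightarrow> g y = f y"
proof -
  obtain U g where U: "open U" "x \<in> U" "\<forall>k. Ck_on k U g" "\<forall>y\<in>S \<inter> U. g y = f y"
    using assms unfolding smooth_on_def by blast
  have "Ck_on (Suc 0) U g" using U(3) by blast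
  then obtain g' where "\<forall>y\<in>U. (g has_derivative g' y) (at y)" "\<forall>v. continuous_on U (\<lambda>y. g' y v)"
    by auto
  then show ?thesis using that U by blast
qed

lemma continuous_on_locally:
  fixes f :: "'a::t2_space \<Rightarrow> 'b::topological_space"
  assumes "\<And>x. x \<in> S \<Longrightarrow> \<exists>M. open M \<and> x \<in> M \<and> continuous_on (S \<inter> M) f"
  shows "continuous_on S f"
  unfolding continuous_on_eq_continuous_within
proof
  fix x assume x: "x \<in> S"
  then obtain M where M: "open M" "x \<in> M" "continuous_on (S \<inter> M) f" using assms by blast
  then have "continuous (at x within S \<inter> M) f"
    using x by (simp add: continuous_on_eq_continuous_within)
  moreover have "at x within S \<inter> M = at x within S"
    by (rule at_within_nhd[OF M(2,1)]) auto
  ultimately show "continuous (at x within S) f" by simp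
qed

locale smooth_torus_action = torus_action I act
  for I :: "'n::finite set" and act :: "complex ^ 'n \<Rightarrow> 'x::t2_space \<Rightarrow> 'x" +
  fixes E :: "'e::euclidean_space set" and \<A> :: "('x set \<times> ('x \<Rightarrow> 'e)) set"
  assumes atlas: "smooth_atlas E \<A>" and smooth: "smooth_action \<A> (torus I) act"
begin

lemma chart_around:
  obtains U \<phi> where "p \<in> U" "open U" "openin (top_of_set E) (\<phi> ` U)"
    "homeomorphism U (\<phi> ` U) \<phi> (inv_into U \<phi>)"
    "smooth_on {(z, y). z \<in> carrier (torus I) \<and> y \<in> \<phi> ` U \<and> act z (inv_into U \<phi> y) \<in> U}
       (\<lambda>(z, y). \<phi> (act z (inv_into U \<phi> y)))"
proof -
  have "p \<in> (\<Union>(U, \<phi>)\<in>\<A>. U)" using atlas by (simp add: smooth_atlas_def)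
  then obtain U \<phi> where U: "(U, \<phi>) \<in> \<A>" "p \<in> U" by auto
  show ?thesis
  proof (rule that[OF U(2)])
    show "open U" "openin (top_of_set E) (\<phi> ` U)" "homeomorphism U (\<phi> ` U) \<phi> (inv_into U \<phi>)"
      using atlas U(1) unfolding smooth_atlas_def by auto
    show "smooth_on {(z, y). z \<in> carrier (torus I) \<and> y \<in> \<phi> ` U \<and> act z (inv_into U \<phi> y) \<in> U}
       (\<lambda>(z, y). \<phi> (act z (inv_into U \<phi> y)))"
      using smooth U(1) unfolding smooth_action_def by fast
  qed
qed

lemma subspace_model: "subspace E"
  using atlas by (simp add: smooth_atlas_def)

text \<open>The local geometry of the strata. Near \<open>p\<close> every stratum is a cone over the points with the same
  isotropy algebra as \<open>p\<close>: it contains a path from any of its points to any such point, except for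
  the end of the path.

  The proof applies the conical neighbourhood to the action of \<open>h = isot p\<close> in a chart \<open>\<phi>\<close> around
  \<open>p\<close>. The chart takes values in the subspace \<open>E\<close>; in order to obtain an action on an open subset of the
  ambient Euclidean space, \<open>E\<close> is multiplied by the kernel of a linear projection \<open>\<pi>\<close> onto \<open>E\<close>, on
  which \<open>h\<close> acts trivially.\<close>
lemma conical_strata:
  "\<exists>V. open V \<and> p \<in> V \<and> (\<forall>q\<in>V. \<forall>p'\<in>V. isot p' = isot p \<longrightarrow>
     p' \<in> closure (connected_component_set {r. isot r = isot q} q))"
proof -
  define h where "h = isot p"
  obtain U \<phi> where U: "p \<in> U" "open U" "openin (top_of_set E) (\<phi> ` U)"
    "homeomorphism U (\<phi> ` U) \<phi> (inv_into U \<phi>)"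
    "smooth_on {(z, y). z \<in> carrier (torus I) \<and> y \<in> \<phi> ` U \<and> act z (inv_into U \<phi> y) \<in> U}
       (\<lambda>(z, y). \<phi> (act z (inv_into U \<phi> y)))"
    by (rule chart_around)
  define \<kappa> where "\<kappa> = inv_into U \<phi>"
  define S where "S = {(z, y). z \<in> carrier (torus I) \<and> y \<in> \<phi> ` U \<and> act z (\<kappa> y) \<in> U}"
  obtain N where N: "open N" "p \<in> N" "\<And>q. q \<in> N \<Longrightarrow> isot q \<subseteq> h"
    using iso_upper_semicontinuous[of p] unfolding h_def by blast
  have stab_sub: "stab p \<subseteq> carrier (torus I)" by (rule subgroup.subset[OF subgroup_stab])
  have stab1: "1 \<in> stab p" using subgroup.one_closed[OF subgroup_stab, of p] by (simp add: one_torus)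
  have "compact (stab p)"
    using compact_Int_closed[OF compact_torus closed_stab, of I p] stab_sub by (simp add: Int_absorb1)
  \<comment> \<open>an invariant neighbourhood of \<open>p\<close> in the chart domain on which isotropy algebras are in \<open>h\<close>\<close>
  define U1 where "U1 = {q. \<forall>z\<in>stab p. act z q \<in> U \<inter> N}"
  have oU1: "open U1"
    unfolding U1_def by (intro open_forall_act_mem \<open>compact (stab p)\<close> stab_sub open_Int U(2) N(1))
  have pU1: "p \<in> U1" using U(1) N(2) by (simp add: U1_def stab_iff)
  have U1U: "U1 \<subseteq> U \<inter> N" using stab1 act_one by (force simp: U1_def)
  have inv: "act z q \<in> U1" if "z \<in> stab p" "q \<in> U1" for z q
    unfolding U1_def
  proof (intro CollectI ballI)
    fix w assume w: "w \<in> stab p"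
    then have "w * z \<in> stab p"
      using subgroup.m_closed[OF subgroup_stab w that(1)] by (simp add: mult_torus)
    moreover have "act w (act z q) = act (w * z) q"
      using w that(1) by (simp add: act_mult stab_iff)
    ultimately show "act w (act z q) \<in> U \<inter> N" using that(2) by (simp add: U1_def)
  qed
  obtain \<pi> :: "'e \<Rightarrow> 'e" where \<pi>: "range \<pi> \<subseteq> E" "linear \<pi>" "\<And>y. y \<in> E \<Longrightarrow> \<pi> y = y"
    using linear_exists_left_inverse_on[OF linear_id subspace_model] by auto
  have \<pi>c: "continuous_on T (\<lambda>x. \<pi> (f x))" if "continuous_on T f" for T and f :: "'z::topological_space \<Rightarrow> 'e"
    using continuous_on_compose2[OF linear_continuous_on[of \<pi> UNIV] that] \<pi>(2)
    by (simp add: linear_conv_bounded_linear)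
  have \<pi>d: "(\<pi> has_derivative \<pi>) F" for F
    using \<pi>(2) by (simp add: linear_conv_bounded_linear bounded_linear_imp_has_derivative)
  have \<pi>lin: "\<pi> (x + y) = \<pi> x + \<pi> y" "\<pi> (x - y) = \<pi> x - \<pi> y" "\<pi> (\<pi> x) = \<pi> x" for x y
    using \<pi> by (auto simp: linear_add linear_diff)
  have \<phi>E: "\<phi> ` U \<subseteq> E" using U(3) openin_imp_subset by blast
  have \<kappa>\<phi>: "\<kappa> (\<phi> q) = q" if "q \<in> U" for q
    using homeomorphism_apply1[OF U(4) that] by (simp add: \<kappa>_def)
  have \<phi>\<kappa>: "\<phi> (\<kappa> y) = y" "\<kappa> y \<in> U" if "y \<in> \<phi> ` U" for y
    using that \<kappa>\<phi> by auto
  define \<Omega> where "\<Omega> = \<pi> -` \<phi> ` U1"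
  have "openin (top_of_set (\<phi> ` U)) (\<phi> ` U1)"
    using oU1 U1U by (intro homeomorphism_imp_open_map[OF U(4)]) (simp add: openin_open_eq U(2))
  then have "openin (top_of_set E) (\<phi> ` U1)" using U(3) openin_trans by blast
  then obtain T where T: "open T" "\<phi> ` U1 = E \<inter> T" by (auto simp: openin_open)
  have "\<Omega> = \<pi> -` T" using \<pi>(1) unfolding \<Omega>_def T(2) by auto
  then have o\<Omega>: "open \<Omega>" using open_vimage[OF T(1) \<pi>c[OF continuous_on_id]] by simp
  define G where "G \<xi> y = \<phi> (act (torus_exp \<xi>) (\<kappa> (\<pi> y))) + (y - \<pi> y)" for \<xi> y
  have hK: "torus_exp \<xi> \<in> stab p" if "\<xi> \<in> h" for \<xi>
    using that lie_algebra_exp by (auto simp: h_def isotropy_algebra_def)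
  have hT: "torus_exp \<xi> \<in> carrier (torus I)" if "\<xi> \<in> h" for \<xi>
    using hK[OF that] stab_sub by blast
  have \<Omega>U1: "\<kappa> (\<pi> y) \<in> U1" "\<pi> y \<in> \<phi> ` U" if "y \<in> \<Omega>" for y
    using that \<kappa>\<phi> U1U by (auto simp: \<Omega>_def)
  have actU1: "act (torus_exp \<xi>) (\<kappa> (\<pi> y)) \<in> U1" if "\<xi> \<in> h" "y \<in> \<Omega>" for \<xi> y
    using inv hK \<Omega>U1 that by blast
  have \<pi>G: "\<pi> (G \<xi> y) = \<phi> (act (torus_exp \<xi>) (\<kappa> (\<pi> y)))" if "\<xi> \<in> h" "y \<in> \<Omega>" for \<xi> y
    using \<pi>(3) \<phi>E actU1[OF that] U1U by (auto simp: G_def \<pi>lin)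
  have \<kappa>G: "\<kappa> (\<pi> (G \<xi> y)) = act (torus_exp \<xi>) (\<kappa> (\<pi> y))" if "\<xi> \<in> h" "y \<in> \<Omega>" for \<xi> y
    using \<kappa>\<phi> actU1[OF that] U1U by (auto simp: \<pi>G[OF that])
  have y0: "\<phi> p \<in> \<Omega>" "\<kappa> (\<pi> (\<phi> p)) = p" "\<pi> (\<phi> p) = \<phi> p"
    using pU1 U(1) \<phi>E \<pi>(3) \<kappa>\<phi> by (auto simp: \<Omega>_def)
  have G_fix: "G \<xi> y = y \<longleftrightarrow> act (torus_exp \<xi>) (\<kappa> (\<pi> y)) = \<kappa> (\<pi> y)" if "\<xi> \<in> h" "y \<in> \<Omega>" for \<xi> y
  proof
    assume "G \<xi> y = y"
    then show "act (torus_exp \<xi>) (\<kappa> (\<pi> y)) = \<kappa> (\<pi> y)" using \<kappa>G[OF that] by simp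
  next
    assume "act (torus_exp \<xi>) (\<kappa> (\<pi> y)) = \<kappa> (\<pi> y)"
    then show "G \<xi> y = y" using \<phi>\<kappa>(1)[OF \<Omega>U1(2)[OF that(2)]] by (simp add: G_def)
  qed
  \<comment> \<open>Smoothness only provides local extensions of \<open>G\<close>, whose derivatives depend on choices; on
    \<open>h \<times> \<Omega>\<close> they agree with the derivative of \<open>G \<xi>\<close>, which is unique as \<open>\<Omega>\<close> is open.\<close>
  have local: "\<exists>M g'. open M \<and> (\<xi>, y) \<in> M \<and>
      (\<forall>\<xi>' y'. \<xi>' \<in> h \<longrightarrow> y' \<in> \<Omega> \<longrightarrow> (\<xi>', y') \<in> M \<longrightarrow> (G \<xi>' has_derivative g' \<xi>' y') (at y')) \<and>
      (\<forall>v. continuous_on M (\<lambda>(\<xi>', y'). g' \<xi>' y' v))"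
    if \<xi>: "\<xi> \<in> h" and y: "y \<in> \<Omega>" for \<xi> y
  proof -
    have mem: "(torus_exp \<xi>, \<pi> y) \<in> S" if "\<xi> \<in> h" "y \<in> \<Omega>" for \<xi> y
      using hT[OF that(1)] \<Omega>U1[OF that(2)] actU1[OF that] U1U by (auto simp: S_def)
    have "smooth_on S (\<lambda>(z, y). \<phi> (act z (\<kappa> y)))"
      using U(5) unfolding S_def \<kappa>_def .
    from smooth_onE[OF this mem[OF \<xi> y]] obtain Q g g' where Q: "open Q" "(torus_exp \<xi>, \<pi> y) \<in> Q"
      and g': "\<And>x. x \<in> Q \<Longrightarrow> (g has_derivative g' x) (at x)" "\<And>v. continuous_on Q (\<lambda>x. g' x v)"
      and g: "\<And>x. x \<in> S \<Longrightarrow> x \<in> Q \<Longrightarrow> g x = (case x of (z, y) \<Rightarrow> \<phi> (act z (\<kappa> y)))"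
      by metis
    define m where "m = (\<lambda>(\<xi> :: real ^ 'n, y). (torus_exp \<xi>, \<pi> y))"
    have m: "continuous_on T m" for T
      unfolding m_def case_prod_unfold by (intro continuous_intros \<pi>c)
    define M where "M = m -` Q"
    have M: "open M" unfolding M_def by (rule open_vimage[OF Q(1) m])
    have "(G \<xi>' has_derivative (\<lambda>v. g' (m (\<xi>', y')) (0, \<pi> v) + (v - \<pi> v))) (at y')"
      if \<xi>': "\<xi>' \<in> h" and y': "y' \<in> \<Omega>" and M': "(\<xi>', y') \<in> M" for \<xi>' y'
    proof -
      have "(g has_derivative g' (m (\<xi>', y'))) (at (torus_exp \<xi>', \<pi> y'))"
        using g'(1)[of "m (\<xi>', y')"] M' by (simp add: M_def m_def)
      moreover have "((\<lambda>y. (torus_exp \<xi>', \<pi> y)) has_derivative (\<lambda>v. (0, \<pi> v))) (at y')"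
        by (intro has_derivative_Pair has_derivative_const \<pi>d)
      ultimately have "((\<lambda>y. g (torus_exp \<xi>', \<pi> y)) has_derivative (\<lambda>v. g' (m (\<xi>', y')) (0, \<pi> v))) (at y')"
        using has_derivative_compose by blast
      then have 1: "((\<lambda>y. g (torus_exp \<xi>', \<pi> y) + (y - \<pi> y)) has_derivative
          (\<lambda>v. g' (m (\<xi>', y')) (0, \<pi> v) + (v - \<pi> v))) (at y')"
        by (intro has_derivative_add has_derivative_diff has_derivative_ident \<pi>d)
      have 2: "open (\<Omega> \<inter> Pair \<xi>' -` M)"
        by (intro open_Int o\<Omega> open_vimage[OF M] continuous_intros)
      show ?thesis
      proof (rule has_derivative_transform_within_open[OF 1 2])
        show "y' \<in> \<Omega> \<inter> Pair \<xi>' -` M" using y' M' by simp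
        show "g (torus_exp \<xi>', \<pi> x) + (x - \<pi> x) = G \<xi>' x" if "x \<in> \<Omega> \<inter> Pair \<xi>' -` M" for x
          using that g[OF mem[OF \<xi>', of x]] by (simp add: M_def m_def G_def)
      qed
    qed
    moreover have "continuous_on M (\<lambda>(\<xi>', y'). g' (m (\<xi>', y')) (0, \<pi> v) + (v - \<pi> v))" for v
    proof -
      have "continuous_on M (\<lambda>x. g' (m x) (0, \<pi> v))"
        by (rule continuous_on_compose2[OF g'(2) m]) (auto simp: M_def)
      then show ?thesis by (simp add: case_prod_unfold continuous_on_add)
    qed
    moreover have "(\<xi>, y) \<in> M" using Q(2) by (simp add: M_def m_def)
    ultimately show ?thesis
      using M by (intro exI[of _ M] exI[of _ "\<lambda>\<xi>' y' v. g' (m (\<xi>', y')) (0, \<pi> v) + (v - \<pi> v)"]) blast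
  qed
  define G' where "G' \<xi> y = Blinfun (frechet_derivative (G \<xi>) (at y))" for \<xi> y
  have G'_eq: "blinfun_apply (G' \<xi> y) = f'" if "(G \<xi> has_derivative f') (at y)" for \<xi> y f'
    using that frechet_derivative_at[OF that]
    by (simp add: G'_def bounded_linear_Blinfun_apply has_derivative_bounded_linear)
  have deriv: "(G \<xi> has_derivative G' \<xi> y) (at y)" if "\<xi> \<in> h" "y \<in> \<Omega>" for \<xi> y
    using local[OF that] that G'_eq by metis
  have contG': "continuous_on (h \<times> \<Omega>) (\<lambda>(\<xi>, y). G' \<xi> y)"
  proof (rule continuous_on_locally)
    fix x assume "x \<in> h \<times> \<Omega>"
    then obtain \<xi> y where x: "x = (\<xi>, y)" "\<xi> \<in> h" "y \<in> \<Omega>" by auto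
    obtain M g' where M: "open M" "(\<xi>, y) \<in> M"
      and g': "\<And>\<xi>' y'. \<xi>' \<in> h \<Longrightarrow> y' \<in> \<Omega> \<Longrightarrow> (\<xi>', y') \<in> M \<Longrightarrow> (G \<xi>' has_derivative g' \<xi>' y') (at y')"
        "\<And>v. continuous_on M (\<lambda>(\<xi>', y'). g' \<xi>' y' v)"
      using local[OF x(2,3)] by metis
    have "continuous_on (h \<times> \<Omega> \<inter> M) (\<lambda>(\<xi>, y). G' \<xi> y)"
    proof (rule continuous_on_blinfun_componentwise)
      fix v
      have "continuous_on (h \<times> \<Omega> \<inter> M) (\<lambda>(\<xi>', y'). g' \<xi>' y' v)"
        by (rule continuous_on_subset[OF g'(2)]) simp
      then show "continuous_on (h \<times> \<Omega> \<inter> M) (\<lambda>x. blinfun_apply (case x of (\<xi>, y) \<Rightarrow> G' \<xi> y) v)"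
        by (rule continuous_on_eq) (auto simp: G'_eq[OF g'(1)])
    qed
    then show "\<exists>M. open M \<and> x \<in> M \<and> continuous_on (h \<times> \<Omega> \<inter> M) (\<lambda>(\<xi>, y). G' \<xi> y)"
      using M x(1) by blast
  qed
  have cont_\<kappa>\<pi>: "continuous_on T (\<lambda>x. \<kappa> (\<pi> (f x)))" if "continuous_on T f" "f ` T \<subseteq> \<Omega>"
    for T and f :: "'z::topological_space \<Rightarrow> 'e"
    using continuous_on_compose2[OF homeomorphism_cont2[OF U(4)] \<pi>c[OF that(1)]] that(2) \<Omega>U1(2)
    by (force simp: \<kappa>_def)
  have contG: "continuous_on (h \<times> \<Omega>) (\<lambda>(\<xi>, y). G \<xi> y)"
    unfolding G_def case_prod_unfold
  proof (intro continuous_intros \<pi>c continuous_on_compose2[OF homeomorphism_cont1[OF U(4)]]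
      continuous_on_act cont_\<kappa>\<pi>)
    show "(\<lambda>x. torus_exp (fst x)) ` (h \<times> \<Omega>) \<subseteq> carrier (torus I)" using hT by auto
    show "(\<lambda>x. act (torus_exp (fst x)) (\<kappa> (\<pi> (snd x)))) ` (h \<times> \<Omega>) \<subseteq> U"
      using actU1 U1U by force
  qed auto
  interpret C1_action h \<Omega> G G' "\<phi> p"
  proof
    show "subspace h" unfolding h_def by (rule subspace_iso)
    show "G \<xi> y \<in> \<Omega>" if "\<xi> \<in> h" "y \<in> \<Omega>" for \<xi> y
      using \<pi>G[OF that] actU1[OF that] by (simp add: \<Omega>_def)
    show "G 0 y = y" if "y \<in> \<Omega>" for y
      using \<phi>\<kappa>(1)[OF \<Omega>U1(2)[OF that]] by (simp add: G_def torus_exp_0 act_one)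
    show "G (\<xi> + \<eta>) y = G \<xi> (G \<eta> y)" if "\<xi> \<in> h" "\<eta> \<in> h" "y \<in> \<Omega>" for \<xi> \<eta> y
      using \<kappa>G[OF that(2,3)] \<pi>G[OF that(2,3)] hT that
      by (simp add: G_def[of "\<xi> + \<eta>"] G_def[of \<xi>] torus_exp_add act_mult) (simp add: G_def)
    show "G \<xi> (\<phi> p) = \<phi> p" if "\<xi> \<in> h" for \<xi>
      using G_fix[OF that y0(1)] hK[OF that] y0(2) by (simp add: stab_iff)
  qed (use o\<Omega> y0(1) deriv contG contG' in auto)
  have "span {u \<in> h. torus_exp u = 1} = h"
    unfolding h_def isotropy_algebra_def by (rule lie_algebra_rational[OF subgroup_stab closed_stab])
  moreover have "{u \<in> h. torus_exp u = 1} \<subseteq> {b \<in> h. \<forall>y\<in>\<Omega>. G b y = y}"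
    using G_fix act_one by auto
  ultimately have span: "span {b \<in> h. \<forall>y\<in>\<Omega>. G b y = y} = h"
    using span_mono[of "{u \<in> h. torus_exp u = 1}" "{b \<in> h. \<forall>y\<in>\<Omega>. G b y = y}"]
      span_minimal[OF Collect_subset subspace_h, of "\<lambda>b. \<forall>y\<in>\<Omega>. G b y = y"]
    by (simp add: subset_antisym)
  obtain W where W: "open W" "\<phi> p \<in> W" "W \<subseteq> \<Omega>"
    and cone: "\<forall>y\<in>W. \<forall>y'\<in>W. (\<forall>\<xi>\<in>h. G \<xi> y' = y') \<longrightarrow>
       (\<exists>\<gamma>. continuous_on {0..1} \<gamma> \<and> \<gamma> ` {0..1} \<subseteq> W \<and> \<gamma> 0 = y' \<and> \<gamma> 1 = y \<and>
         (\<forall>s\<in>{0<..1::real}. \<forall>\<xi>\<in>h. (\<forall>t. G (t *\<^sub>R \<xi>) (\<gamma> s) = \<gamma> s) \<longleftrightarrow> (\<forall>t. G (t *\<^sub>R \<xi>) y = y)))"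
    using conical_neighbourhood[OF span] by (elim exE conjE)
  have iso_eq: "isot (\<kappa> (\<pi> y)) = {\<xi> \<in> h. \<forall>t. G (t *\<^sub>R \<xi>) y = y}" if y: "y \<in> \<Omega>" for y
  proof -
    have "isot (\<kappa> (\<pi> y)) \<subseteq> h" using N(3) \<Omega>U1(1)[OF y] U1U by blast
    then show ?thesis
      using G_fix[OF scale_h y] hT[OF scale_h] by (auto simp: iso_iff stab_iff)
  qed
  define V where "V = U \<inter> \<phi> -` W"
  show ?thesis
  proof (intro exI[of _ V] conjI ballI impI)
    show "open V"
      unfolding V_def using continuous_open_preimage[OF homeomorphism_cont1[OF U(4)] U(2) W(1)] .
    show "p \<in> V" using U(1) W(2) by (simp add: V_def)
    fix q p' assume q: "q \<in> V" and p': "p' \<in> V" and eq: "isot p' = isot p"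
    have recover: "\<kappa> (\<pi> (\<phi> r)) = r" if "r \<in> V" for r
      using that \<kappa>\<phi> \<phi>E \<pi>(3) by (force simp: V_def)
    have qW: "\<phi> q \<in> W" and pW: "\<phi> p' \<in> W" using q p' by (auto simp: V_def)
    have "G \<xi> (\<phi> p') = \<phi> p'" if \<xi>: "\<xi> \<in> h" for \<xi>
    proof -
      have "\<xi> \<in> isot (\<kappa> (\<pi> (\<phi> p')))" using \<xi> recover[OF p'] eq by (simp add: h_def)
      then have "\<forall>t. G (t *\<^sub>R \<xi>) (\<phi> p') = \<phi> p'" using iso_eq pW W(3) by blast
      from spec[OF this, of 1] show ?thesis by simp
    qed
    then have "\<forall>\<xi>\<in>h. G \<xi> (\<phi> p') = \<phi> p'" by blast
    from mp[OF bspec[OF bspec[OF cone qW] pW] this] obtain \<gamma> where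
        \<gamma>: "continuous_on {0..1} \<gamma>" "\<gamma> ` {0..1} \<subseteq> W" "\<gamma> 0 = \<phi> p'" "\<gamma> 1 = \<phi> q"
      and cone\<gamma>: "\<forall>s\<in>{0<..1::real}. \<forall>\<xi>\<in>h.
        (\<forall>t. G (t *\<^sub>R \<xi>) (\<gamma> s) = \<gamma> s) \<longleftrightarrow> (\<forall>t. G (t *\<^sub>R \<xi>) (\<phi> q) = \<phi> q)"
      by (elim exE conjE)
    \<comment> \<open>\<open>\<gamma>\<close> may leave \<open>E\<close>, so it is projected back to \<open>E\<close> before it is mapped to the manifold\<close>
    define c where "c s = \<kappa> (\<pi> (\<gamma> s))" for s
    have cc: "continuous_on {0..1} c"
      unfolding c_def using \<gamma>(1,2) W(3) by (intro cont_\<kappa>\<pi>) auto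
    have c01: "c 0 = p'" "c 1 = q" using \<gamma>(3,4) recover p' q by (simp_all add: c_def)
    have "isot (c s) = isot q" if s: "s \<in> {0<..1}" for s
    proof -
      have "\<gamma> s \<in> \<Omega>" using \<gamma>(2) W(3) s by force
      then have "isot (c s) = isot (\<kappa> (\<pi> (\<phi> q)))"
        using iso_eq bspec[OF cone\<gamma> s] qW W(3) unfolding c_def by blast
      then show ?thesis using recover[OF q] by simp
    qed
    moreover have "connected (c ` {0<..1})"
      by (intro connected_continuous_image continuous_on_subset[OF cc]) auto
    ultimately have *: "c ` {0<..1} \<subseteq> connected_component_set {r. isot r = isot q} q"
    proof (intro connected_component_maximal)
      have "q = c 1" "(1 :: real) \<in> {0<..1}" using c01(2) by auto
      then show "q \<in> c ` {0<..1}" by (rule image_eqI)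
    qed auto
    have **: "c ` closure {0<..1} \<subseteq> closure (c ` {0<..1})"
      using cc by (intro image_closure_subset closure_subset) auto
    show "p' \<in> closure (connected_component_set {r. isot r = isot q} q)"
    proof -
      have "p' \<in> c ` closure {0<..1}" using c01(1) by (intro image_eqI[of _ _ 0]) auto
      then show ?thesis using * ** closure_mono by blast
    qed
  qed
qed

text \<open>If a stratum \<open>Z\<close> comes close enough to \<open>p\<close>, then its closure contains the whole stratum \<open>Y\<close> of
  \<open>p\<close>: by the local geometry \<open>Y \<inter> closure Z\<close> contains \<open>p\<close> and is open in \<open>Y\<close>, and \<open>Y\<close> is
  connected.\<close>
lemma frontier_condition:
  obtains V where "open V" "p \<in> V"
    "\<And>q Y Z. q \<in> V \<Longrightarrow> Y \<in> strata \<Longrightarrow> p \<in> Y \<Longrightarrow> Z \<in> strata \<Longrightarrow> q \<in> Z \<Longrightarrow> Y \<subseteq> closure Z"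
proof -
  have loc: "\<exists>V. open V \<and> p \<in> V \<and> (\<forall>q\<in>V. \<forall>p'\<in>V. \<forall>Z\<in>strata. q \<in> Z \<longrightarrow> isot p' = isot p \<longrightarrow> p' \<in> closure Z)" for p
  proof -
    obtain V where V: "open V" "p \<in> V" and cone: "\<forall>q\<in>V. \<forall>p'\<in>V. isot p' = isot p \<longrightarrow>
        p' \<in> closure (connected_component_set {r. isot r = isot q} q)"
      using conical_strata[of p] by (elim exE conjE)
    have "p' \<in> closure Z" if "q \<in> V" "p' \<in> V" "Z \<in> strata" "q \<in> Z" "isot p' = isot p" for q p' Z
      using cone[rule_format, OF that(1,2,5)] mem_stratum_iso[OF that(3,4)] by simp
    then show ?thesis using V by blast
  qed
  obtain V where V: "open V" "p \<in> V"
    "\<forall>q\<in>V. \<forall>p'\<in>V. \<forall>Z\<in>strata. q \<in> Z \<longrightarrow> isot p' = isot p \<longrightarrow> p' \<in> closure Z"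
    using loc[of p] by (elim exE conjE)
  show ?thesis
  proof (rule that[OF V(1,2)])
    fix q Y Z assume q: "q \<in> V" "q \<in> Z" and Z: "Z \<in> strata" and Y: "Y \<in> strata" "p \<in> Y"
    have "openin (top_of_set Y) (Y \<inter> closure Z)"
    proof (subst openin_subopen, intro ballI)
      fix p' assume p': "p' \<in> Y \<inter> closure Z"
      obtain V' where V': "open V'" "p' \<in> V'"
        "\<forall>q\<in>V'. \<forall>r\<in>V'. \<forall>Z\<in>strata. q \<in> Z \<longrightarrow> isot r = isot p' \<longrightarrow> r \<in> closure Z"
        using loc[of p'] by (elim exE conjE)
      obtain q' where q': "q' \<in> V'" "q' \<in> Z"
        using p' V'(1,2) by (meson IntD2 closure_iff_nhds_not_empty disjoint_iff order_refl)
      have "Y \<inter> V' \<subseteq> closure Z"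
        using V'(3) q' Z iso_on_stratum[OF Y(1)] p' by blast
      then show "\<exists>T. openin (top_of_set Y) T \<and> p' \<in> T \<and> T \<subseteq> Y \<inter> closure Z"
        using V'(1,2) p' by (intro exI[of _ "Y \<inter> V'"]) (auto intro: openin_open_Int)
    qed
    moreover have "closedin (top_of_set Y) (Y \<inter> closure Z)"
      by (intro closedin_closed_Int closed_closure)
    moreover have "p \<in> Y \<inter> closure Z" using V(2,3) q Z Y(2) by blast
    ultimately have "Y \<inter> closure Z = Y"
      using connected_stratum[OF Y(1)] unfolding connected_clopen by blast
    then show "Y \<subseteq> closure Z" by blast
  qed
qed

text \<open>Near \<open>p\<close> all strata lie above the stratum of \<open>p\<close>, so the values of \<open>A'\<close> at them are restrictions
  of its value at the stratum of \<open>p\<close>; and a point fixed by \<open>H\<close> has an isotropy algebra that contains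
  the Lie algebra of \<open>H\<close>.\<close>
lemma pointwise_assignment_of_strata:
  assumes A': "stratum_assignment (torus I) act A'"
  shows "pointwise_assignment (torus I) act (\<lambda>p. A' (stratum_of (torus I) act p))"
  unfolding pointwise_assignment_def
proof (intro conjI allI impI)
  fix p
  show "A' (stratum_of (torus I) act p) \<in> polynomials_on (isot p)"
    using A' stratum_of[of p] stratum_algebra_eq by (metis stratum_assignment_def)
next
  fix H assume "subtorus H (torus I)"
  then have H: "H \<subseteq> carrier (torus I)" by (simp add: subtorus_def subgroup.subset)
  let ?f = "\<lambda>p. restrict (A' (stratum_of (torus I) act p)) (lie_algebra H)"
  show "locally (\<lambda>U. ?f constant_on U) (fixed_set act H)"
    unfolding locally_def
  proof (intro allI impI)
    fix w p assume w: "openin (top_of_set (fixed_set act H)) w \<and> p \<in> w"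
    obtain V where V: "open V" "p \<in> V"
      "\<And>q Y Z. q \<in> V \<Longrightarrow> Y \<in> strata \<Longrightarrow> p \<in> Y \<Longrightarrow> Z \<in> strata \<Longrightarrow> q \<in> Z \<Longrightarrow> Y \<subseteq> closure Z"
      using frontier_condition by metis
    have "?f q = ?f p" if q: "q \<in> w \<inter> V" for q
    proof -
      have "q \<in> fixed_set act H" using q w openin_imp_subset by blast
      then have "lie_algebra H \<subseteq> isot q" by (rule lie_algebra_subset_iso[OF H])
      moreover have "A' (stratum_of (torus I) act q)
          = restrict (A' (stratum_of (torus I) act p)) (isot q)"
        using A' V(3)[of q] q stratum_of[of p] stratum_of[of q] stratum_algebra_eq[of _ q]
        by (metis IntD2 stratum_assignment_def)
      ultimately show ?thesis by (simp add: Int_absorb1)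
    qed
    then have "?f constant_on (w \<inter> V)" unfolding constant_on_def by blast
    moreover have "openin (top_of_set (fixed_set act H)) (w \<inter> V)"
      using w V(1) by (blast intro: openin_Int_open)
    ultimately show "\<exists>U V. openin (top_of_set (fixed_set act H)) U \<and> ?f constant_on V \<and>
        p \<in> U \<and> U \<subseteq> V \<and> V \<subseteq> w"
      using w V(2) by blast
  qed
qed

end


section \<open>Pointwise assignments and stratum assignments\<close>

theorem proposition3p2:
  fixes E :: "'e::euclidean_space set"
    and \<A> :: "('x::{t2_space, second_countable_topology} set \<times> ('x \<Rightarrow> 'e)) set"
    and I :: "'n::finite set"
    and act :: "complex ^ 'n \<Rightarrow> 'x \<Rightarrow> 'x"
  assumes "smooth_atlas E \<A>"
    and "smooth_action \<A> (torus I) act"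
  shows "(\<forall>A. pointwise_assignment (torus I) act A \<longrightarrow>
            (\<forall>Y\<in>infinitesimal_strata (torus I) act. A constant_on Y) \<and>
            stratum_assignment (torus I) act (common_value A)) \<and>
         (\<forall>A'. stratum_assignment (torus I) act A' \<longrightarrow>
            pointwise_assignment (torus I) act (\<lambda>p. A' (stratum_of (torus I) act p)))"
proof -
  interpret smooth_torus_action I act E \<A>
  proof (intro smooth_torus_action.intro torus_action.intro smooth_torus_action_axioms.intro)
    show "group_action (torus I) UNIV act"
      "continuous_on (carrier (torus I) \<times> UNIV) (\<lambda>(z, p). act z p)"
      using assms(2) unfolding smooth_action_def by blast+
  qed (rule assms)+
  show ?thesis
  proof (intro conjI allI impI ballI)
    fix A Y assume "pointwise_assignment (torus I) act A" "Y \<in> infinitesimal_strata (torus I) act"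
    then show "A constant_on Y"
      using assignment_constant_on_stratum unfolding constant_on_def by metis
  qed (fact stratum_assignment_common_value pointwise_assignment_of_strata)+
qed

end
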